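(* Let $n\ge 2$, let $X_1,\dots,X_n$ be Polish spaces with their Borel $\sigma$-algebras, and let $\Omega=X_1\times\cdots\times X_n$ carry the product Borel structure. Let $S\subset\Omega$ be a good Borel set such that any two points of $S$ are related, and suppose there is a uniform upper bound for the lengths of geodesics in $S$. Then every bounded Borel function $f$ on $S$ is of the form $f(x_1,\dots,x_n)=u_1(x_1)+\cdots+u_n(x_n)$ for $(x_1,\dots,x_n)\in S$, with $u_i$ a bounded Borel function on $X_i$, $1\le i\le n$; and $S$ is a set of marginal uniqueness.
   Context: $\Pi_i:\Omega\to X_i$ denotes the canonical projection. A subset $S\subset\Omega$ is good if every complex valued function $f$ on $S$ is of the form $f(x_1,\dots,x_n)=u_1(x_1)+\cdots+u_n(x_n)$ for all $(x_1,\dots,x_n)\in S$, for suitable complex functions $u_i$ on $X_i$. A subset $S\subset\Omega$ is full if $S$ is a maximal good set in $\Pi_1S\times\cdots\times\Pi_nS$, i.e. $S$ is good and is not contained in a strictly larger good subset of $\Pi_1S\times\cdots\times\Pi_nS$. Two points $\vec x,\vec y$ of a good set $S$ are related if some finite full subset of $S$ contains both. Any finite full set $F\subset S$ containing both $\vec x$ and $\vec y$ is called a path joining $\vec x$ and $\vec y$ (in $S$); its length is its cardinality; a path of smallest cardinality joining $\vec x$ and $\vec y$ is called a geodesic. A Borel set $E\subset\Omega$ is a set of marginal uniqueness if every probability measure $\mu$ supported on $E$ is an extreme point of the convex set of all probability measures on $\Omega$ having the same one-dimensional marginals as $\mu$. *)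

theory Defs
  imports "HOL-Probability.Probability"
begin

definition Polish_space :: "'a topology \<Rightarrow> bool" where
  "Polish_space T \<longleftrightarrow> completely_metrizable_space T \<and> separable_space T"

definition borel_of :: "'a topology \<Rightarrow> 'a measure" where
  "borel_of T = sigma (topspace T) {U. openin T U}"

(* The spaces X 1, ..., X n have arbitrary carriers inside one type 'a; as 'a is arbitrary, any
   finite family of spaces can be so represented. Points of the product are functions that are
   extensional on {1..n}. *)
definition prod_space :: "nat \<Rightarrow> (nat \<Rightarrow> 'a topology) \<Rightarrow> (nat \<Rightarrow> 'a) measure" where
  "prod_space n X = Pi\<^sub>M {1..n} (\<lambda>i. borel_of (X i))"

(* Functions on S and on X i are taken total: only their values on S, respectively on the
   projections of S, matter. *)
definition good :: "nat \<Rightarrow> (nat \<Rightarrow> 'a) set \<Rightarrow> bool" where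
  "good n S \<longleftrightarrow>
    (\<forall>f :: (nat \<Rightarrow> 'a) \<Rightarrow> complex. \<exists>u :: nat \<Rightarrow> 'a \<Rightarrow> complex.
       \<forall>x\<in>S. f x = (\<Sum>i\<in>{1..n}. u i (x i)))"

definition proj_box :: "nat \<Rightarrow> (nat \<Rightarrow> 'a) set \<Rightarrow> (nat \<Rightarrow> 'a) set" where
  "proj_box n S = (\<Pi>\<^sub>E i\<in>{1..n}. (\<lambda>x. x i) ` S)"

definition full :: "nat \<Rightarrow> (nat \<Rightarrow> 'a) set \<Rightarrow> bool" where
  "full n S \<longleftrightarrow> good n S \<and> S \<subseteq> proj_box n S \<and>
    \<not> (\<exists>T. good n T \<and> S \<subset> T \<and> T \<subseteq> proj_box n S)"

definition joining_path ::
    "nat \<Rightarrow> (nat \<Rightarrow> 'a) set \<Rightarrow> (nat \<Rightarrow> 'a) \<Rightarrow> (nat \<Rightarrow> 'a) \<Rightarrow> (nat \<Rightarrow> 'a) set \<Rightarrow> bool" where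
  "joining_path n S x y F \<longleftrightarrow> finite F \<and> full n F \<and> F \<subseteq> S \<and> x \<in> F \<and> y \<in> F"

definition related :: "nat \<Rightarrow> (nat \<Rightarrow> 'a) set \<Rightarrow> (nat \<Rightarrow> 'a) \<Rightarrow> (nat \<Rightarrow> 'a) \<Rightarrow> bool" where
  "related n S x y \<longleftrightarrow> (\<exists>F. joining_path n S x y F)"

definition geodesic ::
    "nat \<Rightarrow> (nat \<Rightarrow> 'a) set \<Rightarrow> (nat \<Rightarrow> 'a) \<Rightarrow> (nat \<Rightarrow> 'a) \<Rightarrow> (nat \<Rightarrow> 'a) set \<Rightarrow> bool" where
  "geodesic n S x y F \<longleftrightarrow> joining_path n S x y F \<and>
    (\<forall>G. joining_path n S x y G \<longrightarrow> card F \<le> card G)"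

definition same_marginals ::
    "nat \<Rightarrow> (nat \<Rightarrow> 'a topology) \<Rightarrow> (nat \<Rightarrow> 'a) measure \<Rightarrow> (nat \<Rightarrow> 'a) measure set" where
  "same_marginals n X \<mu> =
    {\<nu>. prob_space \<nu> \<and> sets \<nu> = sets (prod_space n X) \<and>
        (\<forall>i\<in>{1..n}. distr \<nu> (borel_of (X i)) (\<lambda>x. x i) = distr \<mu> (borel_of (X i)) (\<lambda>x. x i))}"

(* The library's extreme_point_of needs a real_vector type, and measures do not form one. This is
   the same definition, with convex combinations of measures taken setwise. *)
definition extreme_measure :: "'b measure \<Rightarrow> 'b measure set \<Rightarrow> bool" where
  "extreme_measure \<mu> C \<longleftrightarrow> \<mu> \<in> C \<and>
    (\<forall>\<nu>\<^sub>1\<in>C. \<forall>\<nu>\<^sub>2\<in>C. \<forall>t::real. 0 < t \<and> t < 1 \<and>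
       (\<forall>A\<in>sets \<mu>. measure \<mu> A = (1 - t) * measure \<nu>\<^sub>1 A + t * measure \<nu>\<^sub>2 A) \<longrightarrow> \<nu>\<^sub>1 = \<nu>\<^sub>2)"

definition marginal_uniqueness ::
    "nat \<Rightarrow> (nat \<Rightarrow> 'a topology) \<Rightarrow> (nat \<Rightarrow> 'a) set \<Rightarrow> bool" where
  "marginal_uniqueness n X E \<longleftrightarrow> E \<in> sets (prod_space n X) \<and>
    (\<forall>\<mu>. prob_space \<mu> \<and> sets \<mu> = sets (prod_space n X) \<and> measure \<mu> E = 1 \<longrightarrow>
       extreme_measure \<mu> (same_marginals n X \<mu>))"

end

theory Submission
  imports Defs
begin

text \<open>
A decomposition \<open>f = u 1 + \<dots> + u n\<close> on \<open>S\<close> exists because \<open>S\<close> is good; the task is to see that the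
functions \<open>u i\<close>, normalised at a base point \<open>w \<in> S\<close>, are bounded and extend to Borel functions on
\<open>X i\<close>.

Let \<open>x \<in> S\<close>, and let \<open>F\<close> be a path joining \<open>w\<close> to \<open>x\<close> with at most \<open>L\<close> points. Maximality of the
full set \<open>F\<close> makes \<open>u i (x i) - u i (w i)\<close> a linear combination of the values of \<open>f\<close> on \<open>F\<close>
(\<open>full_coordinate_combination\<close>). The coefficients can be chosen to depend only on the combinatorial
pattern of \<open>F\<close>, that is, on which points of \<open>F\<close> share which coordinates
(\<open>coordinate_identity_pattern\<close>). Since path lengths are bounded, there are finitely many patterns and
hence a common bound for the coefficients, so the normalised \<open>u i\<close> are bounded.

For measurability, \<open>u i\<close> is a Borel function of the whole path but is wanted as a function of \<open>x i\<close>,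
which is a projection of the path. Since the \<open>i\<close>-th projection of \<open>S\<close> is in general only analytic,
Lusin's separation theorem is used: it shows that a Borel function which is constant on the fibres
of a continuous map factors through a Borel function on the target (\<open>Borel_factor_real\<close>). To keep
analytic sets simple, all Polish spaces are parametrised by closed subsets of the Baire space
(\<open>Polish_continuous_image\<close>), and paths are coded by single elements of the Baire space
(\<open>coordinate_function_Borel\<close>).

Marginal uniqueness follows by applying the representation to indicators of measurable sets: a
measure concentrated on \<open>S\<close> is, among such measures, determined by its marginals
(\<open>marginal_uniqueness_if_bounded_sums\<close>).
\<close>

section \<open>Lusin separation over the Baire space\<close>

text \<open>A base of clopen sets of the Baire space, indexed by finite words.\<close>
definition cyl :: "nat list \<Rightarrow> (nat \<Rightarrow> nat) set" where
  "cyl s = {\<sigma>. \<forall>j<length s. \<sigma> j = s ! j}"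

lemma cyl_Nil: "cyl [] = UNIV"
  by (simp add: cyl_def)

lemma cyl_snoc: "cyl s = (\<Union>a. cyl (s @ [a]))"
  by (auto simp: cyl_def nth_append less_Suc_eq)

lemma open_coordinate: "open {\<sigma>::nat \<Rightarrow> nat. P (\<sigma> k)}"
proof -
  have "open ((\<lambda>\<sigma>::nat \<Rightarrow> nat. \<sigma> k) -` {m. P m})"
    by (rule open_vimage[OF Topological_Spaces.open_discrete continuous_on_product_coordinates])
  then show ?thesis by (simp add: vimage_def)
qed

lemma closed_cyl: "closed (cyl s)"
proof -
  have "- cyl s = (\<Union>j\<in>{..<length s}. {\<sigma>. \<sigma> j \<noteq> s ! j})"
    by (auto simp: cyl_def)
  moreover have "open (\<Union>j\<in>{..<length s}. {\<sigma>::nat \<Rightarrow> nat. \<sigma> j \<noteq> s ! j})"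
    by (intro open_UN ballI open_coordinate)
  ultimately show ?thesis by (simp add: closed_def)
qed

lemma open_contains_cyl:
  assumes "open U" "\<sigma> \<in> U"
  obtains k where "cyl (map \<sigma> [0..<k]) \<subseteq> U"
proof -
  have "openin (product_topology (\<lambda>i::nat. euclidean::nat topology) UNIV) U"
    using assms(1) by (simp only: open_fun_def)
  from product_topology_open_contains_basis[OF this assms(2)]
  obtain X where X: "\<sigma> \<in> Pi\<^sub>E UNIV X" "finite {i. X i \<noteq> UNIV}" "Pi\<^sub>E UNIV X \<subseteq> U"
    unfolding topspace_euclidean by (elim exE conjE)
  define k where "k = Suc (Max (insert 0 {i. X i \<noteq> UNIV}))"
  have "i < k" if "X i \<noteq> UNIV" for i
    unfolding k_def less_Suc_eq_le using X(2) that by (intro Max_ge) auto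
  then have "cyl (map \<sigma> [0..<k]) \<subseteq> Pi\<^sub>E UNIV X"
    using X(1) by (fastforce simp: cyl_def PiE_def Pi_def)
  with X(3) show ?thesis by (intro that[of k]) auto
qed

definition separated :: "'a topology \<Rightarrow> 'a set \<Rightarrow> 'a set \<Rightarrow> bool" where
  "separated T A B \<longleftrightarrow> (\<exists>E\<in>sets (borel_of T). A \<subseteq> E \<and> E \<inter> B = {})"

lemma space_borel_of [simp]: "space (borel_of T) = topspace T"
  by (simp add: borel_of_def space_measure_of_conv)

lemma sets_borel_of: "sets (borel_of T) = sigma_sets (topspace T) {U. openin T U}"
  unfolding borel_of_def by (rule sets_measure_of) (auto dest: openin_subset)

lemma borel_of_openin: "openin T U \<Longrightarrow> U \<in> sets (borel_of T)"
  by (auto simp: sets_borel_of)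

text \<open>This is what makes inseparability hereditary: if two countable unions cannot be separated, then
neither can some member of the first from some member of the second.\<close>
lemma separated_UN:
  fixes A B :: "nat \<Rightarrow> 'a set"
  assumes "\<And>a b. separated T (A a) (B b)"
  shows "separated T (\<Union>a. A a) (\<Union>b. B b)"
proof -
  obtain E where E: "\<And>a b. E a b \<in> sets (borel_of T)" "\<And>a b. A a \<subseteq> E a b" "\<And>a b. E a b \<inter> B b = {}"
    using assms unfolding separated_def by metis
  show ?thesis
    unfolding separated_def
  proof (intro bexI conjI)
    show "(\<Union>a. \<Inter>b. E a b) \<in> sets (borel_of T)"
      using E(1) by (intro sets.countable_UN sets.countable_INT) auto
    show "(\<Union>a. A a) \<subseteq> (\<Union>a. \<Inter>b. E a b)"
      using E(2) by (intro UN_mono INT_greatest) auto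
    have "x \<notin> B b" if "x \<in> E a b" for x a b
      using E(3)[of a b] that by auto
    then show "(\<Union>a. \<Inter>b. E a b) \<inter> (\<Union>b. B b) = {}"
      by auto
  qed
qed

text \<open>If the two images were inseparable, inseparability would descend to ever smaller pairs of
cylinders and thereby select one branch \<open>\<sigma>\<close> for \<open>C\<close> and one branch \<open>\<tau>\<close> for \<open>D\<close>. Both branches meet their
closed set in every cylinder, hence lie in it. But \<open>f \<sigma>\<close> and \<open>g \<tau>\<close> are different points with disjoint
neighbourhoods, and by continuity those neighbourhoods separate the images of two small cylinders.\<close>
theorem Lusin_separation:
  fixes C D :: "(nat \<Rightarrow> nat) set"
  assumes "Hausdorff_space T" "closed C" "closed D"
    and f: "continuous_map (top_of_set C) T f" and g: "continuous_map (top_of_set D) T g"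
    and disj: "f ` C \<inter> g ` D = {}"
  shows "separated T (f ` C) (g ` D)"
proof (rule ccontr)
  assume neg: "\<not> ?thesis"
  let ?bad = "\<lambda>s t. \<not> separated T (f ` (C \<inter> cyl s)) (g ` (D \<inter> cyl t))"
  have step: "\<exists>a b. ?bad (s @ [a]) (t @ [b])" if "?bad s t" for s t
  proof (rule ccontr)
    assume "\<nexists>a b. ?bad (s @ [a]) (t @ [b])"
    then have "separated T (\<Union>a. f ` (C \<inter> cyl (s @ [a]))) (\<Union>b. g ` (D \<inter> cyl (t @ [b])))"
      by (intro separated_UN) auto
    moreover have "(\<Union>a. f ` (C \<inter> cyl (s @ [a]))) = f ` (C \<inter> cyl s)"
      using cyl_snoc[of s] by blast
    moreover have "(\<Union>b. g ` (D \<inter> cyl (t @ [b]))) = g ` (D \<inter> cyl t)"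
      using cyl_snoc[of t] by blast
    ultimately show False using that by simp
  qed
  have "\<exists>x. \<forall>n. (length (fst (x n)) = n \<and> length (snd (x n)) = n \<and> ?bad (fst (x n)) (snd (x n)))
      \<and> (\<exists>a b. fst (x (Suc n)) = fst (x n) @ [a] \<and> snd (x (Suc n)) = snd (x n) @ [b])"
  proof (intro dependent_nat_choice)
    show "\<exists>x. length (fst x) = 0 \<and> length (snd x) = 0 \<and> ?bad (fst x) (snd x)"
      by (rule exI[of _ "([], [])"]) (use neg in \<open>simp add: cyl_Nil\<close>)
    fix x :: "nat list \<times> nat list" and n
    assume x: "length (fst x) = n \<and> length (snd x) = n \<and> ?bad (fst x) (snd x)"
    then obtain a b where "?bad (fst x @ [a]) (snd x @ [b])" using step by blast
    then show "\<exists>y. (length (fst y) = Suc n \<and> length (snd y) = Suc n \<and> ?bad (fst y) (snd y))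
       \<and> (\<exists>a b. fst y = fst x @ [a] \<and> snd y = snd x @ [b])"
      using x by (intro exI[of _ "(fst x @ [a], snd x @ [b])"]) auto
  qed
  then obtain x where len: "\<And>n. length (fst (x n)) = n" "\<And>n. length (snd (x n)) = n"
    and bad: "\<And>n. ?bad (fst (x n)) (snd (x n))"
    and suc: "\<And>n. \<exists>a b. fst (x (Suc n)) = fst (x n) @ [a] \<and> snd (x (Suc n)) = snd (x n) @ [b]"
    by blast
  define \<sigma> where "\<sigma> = (\<lambda>j. fst (x (Suc j)) ! j)"
  define \<tau> where "\<tau> = (\<lambda>j. snd (x (Suc j)) ! j)"
  have branch: "fst (x n) = map \<sigma> [0..<n] \<and> snd (x n) = map \<tau> [0..<n]" for n
  proof (induction n)
    case 0
    then show ?case using len(1)[of 0] len(2)[of 0] by simp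
  next
    case (Suc n)
    obtain a b where ab: "fst (x (Suc n)) = fst (x n) @ [a]" "snd (x (Suc n)) = snd (x n) @ [b]"
      using suc by blast
    then have "\<sigma> n = a" "\<tau> n = b"
      using len[of n] by (auto simp: \<sigma>_def \<tau>_def nth_append)
    with ab Suc show ?case by simp
  qed
  have bad': "?bad (map \<sigma> [0..<n]) (map \<tau> [0..<n])" for n
    using bad[of n] branch[of n] by simp
  have sub: "f ` C \<subseteq> topspace T" "g ` D \<subseteq> topspace T"
    using f g by (auto simp: continuous_map_def Pi_def)
  have "C \<inter> cyl (map \<sigma> [0..<n]) \<noteq> {}" for n
  proof
    assume "C \<inter> cyl (map \<sigma> [0..<n]) = {}"
    then have "separated T (f ` (C \<inter> cyl (map \<sigma> [0..<n]))) (g ` (D \<inter> cyl (map \<tau> [0..<n])))"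
      unfolding separated_def by (intro bexI[of _ "{}"]) auto
    with bad'[of n] show False by simp
  qed
  then have \<sigma>C: "\<sigma> \<in> C"
    using open_contains_cyl[of "- C" \<sigma>] \<open>closed C\<close> by (metis ComplI disjoint_eq_subset_Compl inf_commute open_Compl)
  have "D \<inter> cyl (map \<tau> [0..<n]) \<noteq> {}" for n
  proof
    assume "D \<inter> cyl (map \<tau> [0..<n]) = {}"
    then have "separated T (f ` (C \<inter> cyl (map \<sigma> [0..<n]))) (g ` (D \<inter> cyl (map \<tau> [0..<n])))"
      unfolding separated_def using sub by (intro bexI[of _ "topspace T"] borel_of_openin) auto
    with bad'[of n] show False by simp
  qed
  then have \<tau>D: "\<tau> \<in> D"
    using open_contains_cyl[of "- D" \<tau>] \<open>closed D\<close> by (metis ComplI disjoint_eq_subset_Compl inf_commute open_Compl)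
  have "f \<sigma> \<noteq> g \<tau>" "f \<sigma> \<in> topspace T" "g \<tau> \<in> topspace T"
    using disj \<sigma>C \<tau>D sub by auto
  then obtain U V where UV: "openin T U" "openin T V" "f \<sigma> \<in> U" "g \<tau> \<in> V" "disjnt U V"
    using \<open>Hausdorff_space T\<close> unfolding Hausdorff_space_def by metis
  \<comment> \<open>Continuity squeezes the images of two long enough cylinders into \<open>U\<close> and \<open>V\<close>.\<close>
  have local_nbhd: "\<exists>k. h ` (E \<inter> cyl (map \<rho> [0..<k])) \<subseteq> W"
    if "continuous_map (top_of_set E) T h" "openin T W" "\<rho> \<in> E" "h \<rho> \<in> W" for h E \<rho> W
  proof -
    have "openin (top_of_set E) {\<xi> \<in> topspace (top_of_set E). h \<xi> \<in> W}"
      using that(1,2) by (rule openin_continuous_map_preimage)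
    then obtain O' where O': "open O'" "{\<xi> \<in> E. h \<xi> \<in> W} = E \<inter> O'"
      by (auto simp: openin_open)
    have "\<rho> \<in> O'" using O' that by blast
    then obtain k where "cyl (map \<rho> [0..<k]) \<subseteq> O'" using O'(1) open_contains_cyl by blast
    then show ?thesis using O'(2) by blast
  qed
  from local_nbhd[OF f UV(1) \<sigma>C UV(3)] obtain k
    where k: "f ` (C \<inter> cyl (map \<sigma> [0..<k])) \<subseteq> U" ..
  from local_nbhd[OF g UV(2) \<tau>D UV(4)] obtain l
    where l: "g ` (D \<inter> cyl (map \<tau> [0..<l])) \<subseteq> V" ..
  have mono: "cyl (map \<rho> [0..<max k l]) \<subseteq> cyl (map \<rho> [0..<m])" if "m \<le> max k l" for m \<rho>
    using that by (auto simp: cyl_def)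
  have "separated T (f ` (C \<inter> cyl (map \<sigma> [0..<max k l]))) (g ` (D \<inter> cyl (map \<tau> [0..<max k l])))"
    unfolding separated_def
  proof (intro bexI[of _ U] conjI)
    show "f ` (C \<inter> cyl (map \<sigma> [0..<max k l])) \<subseteq> U"
      using k image_mono[OF Int_mono[OF order.refl mono[of k \<sigma>]]] by (meson max.cobounded1 order_trans)
    have "g ` (D \<inter> cyl (map \<tau> [0..<max k l])) \<subseteq> V"
      using l image_mono[OF Int_mono[OF order.refl mono[of l \<tau>]]] by (meson max.cobounded2 order_trans)
    then show "U \<inter> g ` (D \<inter> cyl (map \<tau> [0..<max k l])) = {}"
      using UV(5) by (auto simp: disjnt_def)
  qed (rule borel_of_openin[OF UV(1)])
  with bad'[of "max k l"] show False by (rule notE)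
qed

section \<open>Borel sets of the Baire space\<close>

text \<open>Analytic sets, encoded as projections of closed sets: with the extra coordinate as a free
witness, countable unions and intersections amount to packing countably many witnesses into one.\<close>
definition closed_projection :: "(nat \<Rightarrow> nat) set \<Rightarrow> bool" where
  "closed_projection D \<longleftrightarrow> (\<exists>C :: ((nat \<Rightarrow> nat) \<times> (nat \<Rightarrow> nat)) set. closed C \<and> D = fst ` C)"

lemma continuous_on_reindex:
  "continuous_on A (\<lambda>\<sigma>::nat \<Rightarrow> nat. \<lambda>m. \<sigma> (e m))"
  by (intro continuous_on_coordinatewise_then_product)
     (rule continuous_on_subset[OF continuous_on_product_coordinates], simp)

lemma closed_projection_closed: "closed D \<Longrightarrow> closed_projection D"
  unfolding closed_projection_def by (intro exI[of _ "D \<times> UNIV"]) (auto intro: closed_Times)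

lemma continuous_on_snd_reindex:
  "continuous_on A (\<lambda>p :: (nat \<Rightarrow> nat) \<times> (nat \<Rightarrow> nat). (fst p, \<lambda>m. snd p (e m)))"
  by (intro continuous_on_Pair continuous_on_fst continuous_on_id
      continuous_on_compose2[OF continuous_on_reindex[of UNIV] continuous_on_snd[OF continuous_on_id]]) simp

text \<open>The witness starts with the index of the set that contains the point.\<close>
lemma closed_projection_UN:
  fixes D :: "nat \<Rightarrow> (nat \<Rightarrow> nat) set"
  assumes "\<And>k. closed_projection (D k)"
  shows "closed_projection (\<Union>k. D k)"
proof -
  from assms have "\<forall>k. \<exists>C :: ((nat \<Rightarrow> nat) \<times> (nat \<Rightarrow> nat)) set. closed C \<and> D k = fst ` C"
    unfolding closed_projection_def by simp
  then obtain C :: "nat \<Rightarrow> ((nat \<Rightarrow> nat) \<times> (nat \<Rightarrow> nat)) set"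
    where C: "\<forall>k. closed (C k) \<and> D k = fst ` C k" by (rule choice[THEN exE])
  define E where "E = {p :: (nat \<Rightarrow> nat) \<times> (nat \<Rightarrow> nat). \<forall>k. snd p 0 = k \<longrightarrow> (fst p, \<lambda>m. snd p (Suc m)) \<in> C k}"
  have "closed E"
    unfolding E_def
  proof (intro closed_Collect_all closed_Collect_imp)
    fix k
    have "open (snd -` {\<sigma>. \<sigma> 0 = k} :: ((nat \<Rightarrow> nat) \<times> (nat \<Rightarrow> nat)) set)"
      by (intro open_vimage open_coordinate continuous_on_snd continuous_on_id)
    then show "open {p :: (nat \<Rightarrow> nat) \<times> (nat \<Rightarrow> nat). snd p 0 = k}"
      by (simp add: vimage_def)
    have "closed ((\<lambda>p :: (nat \<Rightarrow> nat) \<times> (nat \<Rightarrow> nat). (fst p, \<lambda>m. snd p (Suc m))) -` C k)"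
      by (rule closed_vimage[OF _ continuous_on_snd_reindex]) (simp add: C)
    then show "closed {p :: (nat \<Rightarrow> nat) \<times> (nat \<Rightarrow> nat). (fst p, \<lambda>m. snd p (Suc m)) \<in> C k}"
      by (simp add: vimage_def)
  qed
  moreover have "(\<Union>k. D k) = fst ` E"
  proof (intro equalityI subsetI)
    fix \<sigma> assume "\<sigma> \<in> (\<Union>k. D k)"
    then obtain k \<tau> where "(\<sigma>, \<tau>) \<in> C k" using C by auto
    then have "(\<sigma>, case_nat k \<tau>) \<in> E" by (simp add: E_def)
    then show "\<sigma> \<in> fst ` E" by (rule image_eqI[rotated]) simp
  next
    fix \<sigma> assume "\<sigma> \<in> fst ` E"
    then obtain p where p: "p \<in> E" "\<sigma> = fst p" by (rule imageE)
    then have "(\<sigma>, \<lambda>m. snd p (Suc m)) \<in> C (snd p 0)" by (simp add: E_def)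
    then have "\<sigma> \<in> fst ` C (snd p 0)" by (rule image_eqI[rotated]) simp
    then show "\<sigma> \<in> (\<Union>k. D k)" using C by auto
  qed
  ultimately show ?thesis unfolding closed_projection_def by (intro exI[of _ E] conjI)
qed

text \<open>One witness interleaves the witnesses for all the sets.\<close>
lemma closed_projection_INT:
  fixes D :: "nat \<Rightarrow> (nat \<Rightarrow> nat) set"
  assumes "\<And>k. closed_projection (D k)"
  shows "closed_projection (\<Inter>k. D k)"
proof -
  from assms have "\<forall>k. \<exists>C :: ((nat \<Rightarrow> nat) \<times> (nat \<Rightarrow> nat)) set. closed C \<and> D k = fst ` C"
    unfolding closed_projection_def by simp
  then obtain C :: "nat \<Rightarrow> ((nat \<Rightarrow> nat) \<times> (nat \<Rightarrow> nat)) set"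
    where C: "\<forall>k. closed (C k) \<and> D k = fst ` C k" by (rule choice[THEN exE])
  define E where "E = {p :: (nat \<Rightarrow> nat) \<times> (nat \<Rightarrow> nat). \<forall>k. (fst p, \<lambda>m. snd p (prod_encode (k, m))) \<in> C k}"
  have "closed E"
    unfolding E_def
  proof (intro closed_Collect_all)
    fix k
    have "closed ((\<lambda>p :: (nat \<Rightarrow> nat) \<times> (nat \<Rightarrow> nat). (fst p, \<lambda>m. snd p (prod_encode (k, m)))) -` C k)"
      by (rule closed_vimage[OF _ continuous_on_snd_reindex]) (simp add: C)
    then show "closed {p :: (nat \<Rightarrow> nat) \<times> (nat \<Rightarrow> nat). (fst p, \<lambda>m. snd p (prod_encode (k, m))) \<in> C k}"
      by (simp add: vimage_def)
  qed
  moreover have "(\<Inter>k. D k) = fst ` E"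
  proof (intro equalityI subsetI)
    fix \<sigma> assume "\<sigma> \<in> (\<Inter>k. D k)"
    then have "\<forall>k. \<sigma> \<in> fst ` C k" using C by simp
    have "\<exists>\<tau>. (\<sigma>, \<tau>) \<in> C k" for k
    proof -
      have "\<sigma> \<in> fst ` C k" using \<open>\<forall>k. \<sigma> \<in> fst ` C k\<close> ..
      then obtain p where "p \<in> C k" "\<sigma> = fst p" by (rule imageE)
      then have "(\<sigma>, snd p) \<in> C k" by simp
      then show ?thesis by (rule exI[of _ "snd p"])
    qed
    then have "\<forall>k. \<exists>\<tau>. (\<sigma>, \<tau>) \<in> C k" ..
    then obtain \<tau> where "\<forall>k. (\<sigma>, \<tau> k) \<in> C k" by (rule choice[THEN exE])
    then have "(\<sigma>, \<lambda>j. \<tau> (fst (prod_decode j)) (snd (prod_decode j))) \<in> E" by (simp add: E_def)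
    then show "\<sigma> \<in> fst ` E" by (rule image_eqI[rotated]) simp
  next
    fix \<sigma> assume "\<sigma> \<in> fst ` E"
    then obtain p where p: "p \<in> E" "\<sigma> = fst p" by (rule imageE)
    have "\<sigma> \<in> fst ` C k" for k
    proof -
      have "(\<sigma>, \<lambda>m. snd p (prod_encode (k, m))) \<in> C k" using p by (simp add: E_def)
      then show ?thesis by (rule image_eqI[rotated]) simp
    qed
    then show "\<sigma> \<in> (\<Inter>k. D k)" using C by auto
  qed
  ultimately show ?thesis unfolding closed_projection_def by (intro exI[of _ E] conjI)
qed

lemma closed_projection_open:
  assumes "open U" shows "closed_projection U"
proof -
  let ?D = "\<lambda>k. if cyl (from_nat k) \<subseteq> U then cyl (from_nat k) else {}"
  have "U = (\<Union>k. ?D k)"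
  proof (intro equalityI subsetI)
    fix \<sigma> assume "\<sigma> \<in> U"
    then obtain k where "cyl (map \<sigma> [0..<k]) \<subseteq> U" using open_contains_cyl assms by blast
    then have "\<sigma> \<in> ?D (to_nat (map \<sigma> [0..<k]))" by (simp add: cyl_def)
    then show "\<sigma> \<in> (\<Union>k. ?D k)" by blast
  qed (auto split: if_splits)
  moreover have "closed_projection (\<Union>k. ?D k)"
    by (intro closed_projection_UN closed_projection_closed) (simp add: closed_cyl)
  ultimately show ?thesis by simp
qed

text \<open>The induction carries the complement along, because the class of analytic sets is not closed
under complements.\<close>
lemma closed_projection_Borel:
  assumes "D \<in> sets (borel :: (nat \<Rightarrow> nat) measure)"
  shows "closed_projection D"
proof -
  have "D \<in> sigma_sets UNIV {U :: (nat \<Rightarrow> nat) set. open U}"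
    using assms by (simp add: borel_def)
  then have "closed_projection D \<and> closed_projection (- D)"
  proof induction
    case (Basic U)
    then show ?case by (auto intro: closed_projection_open closed_projection_closed)
  next
    case Empty
    then show ?case by (auto intro: closed_projection_open)
  next
    case (Compl D)
    then show ?case by (simp add: Compl_eq_Diff_UNIV[symmetric])
  next
    case (Union D)
    then show ?case by (auto intro: closed_projection_UN closed_projection_INT)
  qed
  then show ?thesis by simp
qed

text \<open>The projection is turned into a continuous image of a closed subset of the Baire space itself, the
form that the separation theorem needs, by interleaving point and witness.\<close>
lemma Borel_closed_image:
  assumes "D \<in> sets (borel :: (nat \<Rightarrow> nat) measure)"
  shows "\<exists>(C :: (nat \<Rightarrow> nat) set) (\<phi> :: (nat \<Rightarrow> nat) \<Rightarrow> nat \<Rightarrow> nat).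
    closed C \<and> continuous_on UNIV \<phi> \<and> D = \<phi> ` C"
proof -
  obtain K :: "((nat \<Rightarrow> nat) \<times> (nat \<Rightarrow> nat)) set" where K: "closed K" "D = fst ` K"
    using closed_projection_Borel[OF assms] unfolding closed_projection_def by blast
  define \<phi> where "\<phi> = (\<lambda>\<sigma>::nat \<Rightarrow> nat. \<lambda>m. \<sigma> (2 * m))"
  define \<psi> where "\<psi> = (\<lambda>\<sigma>::nat \<Rightarrow> nat. \<lambda>m. \<sigma> (Suc (2 * m)))"
  define C where "C = (\<lambda>\<sigma>. (\<phi> \<sigma>, \<psi> \<sigma>)) -` K"
  have cont: "continuous_on UNIV \<phi>" "continuous_on UNIV \<psi>"
    unfolding \<phi>_def \<psi>_def by (rule continuous_on_reindex)+
  have "closed C"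
    unfolding C_def by (rule closed_vimage[OF K(1) continuous_on_Pair[OF cont]])
  moreover have "D = \<phi> ` C"
  proof (intro equalityI subsetI)
    fix \<sigma> assume "\<sigma> \<in> D"
    then obtain p where p: "p \<in> K" "\<sigma> = fst p" unfolding K(2) by (rule imageE)
    define \<rho> where "\<rho> = (\<lambda>j. if even j then fst p (j div 2) else snd p (j div 2))"
    have "\<phi> \<rho> = fst p" "\<psi> \<rho> = snd p" by (simp_all add: \<phi>_def \<psi>_def \<rho>_def)
    with p show "\<sigma> \<in> \<phi> ` C" by (intro image_eqI[of _ _ \<rho>]) (simp_all add: C_def)
  next
    fix \<sigma> assume "\<sigma> \<in> \<phi> ` C"
    then obtain \<rho> where \<rho>: "\<sigma> = \<phi> \<rho>" "\<rho> \<in> C" by (rule imageE)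
    then show "\<sigma> \<in> D" unfolding K(2) by (intro image_eqI[of _ _ "(\<phi> \<rho>, \<psi> \<rho>)"]) (simp_all add: C_def)
  qed
  ultimately show ?thesis using cont(1) by (intro exI[of _ C] exI[of _ \<phi>] conjI)
qed

lemma separated_Borel_images:
  fixes K D E :: "(nat \<Rightarrow> nat) set"
  assumes "Hausdorff_space T" and g: "continuous_map (top_of_set K) T g"
    and "D \<in> sets borel" "E \<in> sets borel" "D \<subseteq> K" "E \<subseteq> K" "g ` D \<inter> g ` E = {}"
  shows "separated T (g ` D) (g ` E)"
proof -
  from Borel_closed_image[OF \<open>D \<in> sets borel\<close>]
  obtain C :: "(nat \<Rightarrow> nat) set" and \<phi> :: "(nat \<Rightarrow> nat) \<Rightarrow> nat \<Rightarrow> nat"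
    where C: "closed C" "continuous_on UNIV \<phi>" "D = \<phi> ` C"
    by (elim exE conjE)
  from Borel_closed_image[OF \<open>E \<in> sets borel\<close>]
  obtain C' :: "(nat \<Rightarrow> nat) set" and \<phi>' :: "(nat \<Rightarrow> nat) \<Rightarrow> nat \<Rightarrow> nat"
    where C': "closed C'" "continuous_on UNIV \<phi>'" "E = \<phi>' ` C'"
    by (elim exE conjE)
  have compose: "continuous_map (top_of_set A) T (g \<circ> \<theta>)"
    if "continuous_on UNIV \<theta>" "\<theta> ` A \<subseteq> K" for A :: "(nat \<Rightarrow> nat) set" and \<theta>
  proof (rule continuous_map_compose[OF _ g])
    show "continuous_map (top_of_set A) (top_of_set K) \<theta>"
      using continuous_on_subset[OF that(1)] that(2)
      by (simp add: continuous_map_in_subtopology image_subset_iff_funcset)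
  qed
  have "separated T ((g \<circ> \<phi>) ` C) ((g \<circ> \<phi>') ` C')"
  proof (rule Lusin_separation[OF assms(1) C(1) C'(1)])
    show "continuous_map (top_of_set C) T (g \<circ> \<phi>)"
      by (rule compose[OF C(2)]) (use \<open>D \<subseteq> K\<close> C(3) in simp)
    show "continuous_map (top_of_set C') T (g \<circ> \<phi>')"
      by (rule compose[OF C'(2)]) (use \<open>E \<subseteq> K\<close> C'(3) in simp)
    show "(g \<circ> \<phi>) ` C \<inter> (g \<circ> \<phi>') ` C' = {}"
      using assms(7) by (simp only: image_comp[symmetric] C(3) C'(3))
  qed
  then show ?thesis by (simp only: image_comp[symmetric] C(3) C'(3))
qed

text \<open>A Borel function that is constant on the fibres of \<open>g\<close> factors through a Borel function on the
whole target space, although the image of \<open>g\<close> need not be Borel. The images of \<open>{h \<le> q}\<close> and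
\<open>{h > q}\<close> are disjoint, so a Borel set \<open>E q\<close> separates them; the factor is read off from the sets
\<open>E q\<close> with rational \<open>q\<close>.\<close>
lemma Borel_factor_real:
  fixes K Z :: "(nat \<Rightarrow> nat) set" and h :: "(nat \<Rightarrow> nat) \<Rightarrow> real"
  assumes "Hausdorff_space T" and g: "continuous_map (top_of_set K) T g"
    and Z: "Z \<in> sets borel" "Z \<subseteq> K"
    and h: "h \<in> borel_measurable (restrict_space borel Z)"
    and b: "\<And>\<sigma>. \<sigma> \<in> Z \<Longrightarrow> \<bar>h \<sigma>\<bar> \<le> b"
    and fac: "\<And>\<sigma> \<tau>. \<sigma> \<in> Z \<Longrightarrow> \<tau> \<in> Z \<Longrightarrow> g \<sigma> = g \<tau> \<Longrightarrow> h \<sigma> = h \<tau>"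
  shows "\<exists>v\<in>borel_measurable (borel_of T). (\<forall>x. \<bar>v x\<bar> \<le> \<bar>b\<bar>) \<and> (\<forall>\<sigma>\<in>Z. v (g \<sigma>) = h \<sigma>)"
proof -
  have "\<exists>E\<in>sets (borel_of T). \<forall>\<sigma>\<in>Z. g \<sigma> \<in> E \<longleftrightarrow> h \<sigma> \<le> q" for q
  proof -
    let ?D = "{\<sigma> \<in> Z. h \<sigma> \<le> q}" and ?E = "{\<sigma> \<in> Z. q < h \<sigma>}"
    have "h -` {..q} \<inter> space (restrict_space borel Z) = ?D"
      "h -` {q<..} \<inter> space (restrict_space borel Z) = ?E"
      by (auto simp: space_restrict_space)
    then have "?D \<in> sets (restrict_space borel Z)" "?E \<in> sets (restrict_space borel Z)"
      using measurable_sets[OF h, of "{..q}"] measurable_sets[OF h, of "{q<..}"] by simp_all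
    then have DE: "?D \<in> sets borel" "?E \<in> sets borel"
      using Z(1) by (simp_all add: sets_restrict_space_iff)
    have "g \<sigma> \<noteq> g \<tau>" if "\<sigma> \<in> ?D" "\<tau> \<in> ?E" for \<sigma> \<tau>
      using fac[of \<sigma> \<tau>] that by auto
    then have "g ` ?D \<inter> g ` ?E = {}" by blast
    then have "separated T (g ` ?D) (g ` ?E)"
      using Z(2) by (intro separated_Borel_images[OF assms(1) g DE]) auto
    then obtain E where E: "E \<in> sets (borel_of T)" "g ` ?D \<subseteq> E" "E \<inter> g ` ?E = {}"
      unfolding separated_def by (elim bexE conjE)
    show ?thesis
    proof (intro bexI[of _ E] ballI iffI)
      fix \<sigma> assume "\<sigma> \<in> Z"
      show "h \<sigma> \<le> q" if "g \<sigma> \<in> E"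
      proof (rule ccontr)
        assume "\<not> h \<sigma> \<le> q"
        then have "g \<sigma> \<in> g ` ?E" using \<open>\<sigma> \<in> Z\<close> by simp
        with that E(3) show False by (simp add: disjoint_iff)
      qed
      from \<open>\<sigma> \<in> Z\<close> show "g \<sigma> \<in> E" if "h \<sigma> \<le> q"
        using E(2) that by auto
    qed (rule E(1))
  qed
  then have "\<forall>q. \<exists>E. E \<in> sets (borel_of T) \<and> (\<forall>\<sigma>\<in>Z. g \<sigma> \<in> E \<longleftrightarrow> h \<sigma> \<le> q)"
    by (simp add: Bex_def)
  then obtain E where "\<forall>q. E q \<in> sets (borel_of T) \<and> (\<forall>\<sigma>\<in>Z. g \<sigma> \<in> E q \<longleftrightarrow> h \<sigma> \<le> q)"
    by (rule choice[THEN exE])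
  then have E: "E q \<in> sets (borel_of T)" "\<sigma> \<in> Z \<Longrightarrow> g \<sigma> \<in> E q \<longleftrightarrow> h \<sigma> \<le> q" for q \<sigma>
    by simp_all
  \<comment> \<open>The infimum of the rational upper bounds, cut off so that it exists and stays bounded.\<close>
  define w where "w x = (INF q\<in>\<rat>. if x \<in> E q then max q (- \<bar>b\<bar>) else \<bar>b\<bar>)" for x
  define v where "v x = max (- \<bar>b\<bar>) (min \<bar>b\<bar> (w x))" for x
  have [measurable]: "w \<in> borel_measurable (borel_of T)"
    unfolding w_def
  proof (intro borel_measurable_cINF_real countable_rat)
    fix q :: real
    show "(\<lambda>x. if x \<in> E q then max q (- \<bar>b\<bar>) else \<bar>b\<bar>) \<in> borel_measurable (borel_of T)"
      using E(1)[of q] by measurable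
  qed
  show ?thesis
  proof (intro bexI[of _ v] conjI allI ballI)
    show "v \<in> borel_measurable (borel_of T)" unfolding v_def by measurable
    show "\<bar>v x\<bar> \<le> \<bar>b\<bar>" for x by (auto simp: v_def)
    fix \<sigma> assume \<sigma>: "\<sigma> \<in> Z"
    have bb: "\<bar>h \<sigma>\<bar> \<le> \<bar>b\<bar>" using b[OF \<sigma>] by simp
    have w: "w (g \<sigma>) = (INF q\<in>\<rat>. if h \<sigma> \<le> q then max q (- \<bar>b\<bar>) else \<bar>b\<bar>)"
      unfolding w_def using E(2)[OF \<sigma>] by simp
    have "w (g \<sigma>) \<ge> h \<sigma>"
      unfolding w
    proof (rule cINF_greatest)
      show "(\<rat> :: real set) \<noteq> {}" using Rats_0 by blast
      fix q :: real
      show "h \<sigma> \<le> (if h \<sigma> \<le> q then max q (- \<bar>b\<bar>) else \<bar>b\<bar>)"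
        using bb by auto
    qed
    moreover
    have "w (g \<sigma>) \<le> y" if "y > h \<sigma>" for y
    proof -
      obtain q where q: "q \<in> \<rat>" "h \<sigma> < q" "q < y" using Rats_dense_in_real[OF \<open>y > h \<sigma>\<close>] by blast
      have "w (g \<sigma>) \<le> (if h \<sigma> \<le> q then max q (- \<bar>b\<bar>) else \<bar>b\<bar>)"
        unfolding w
      proof (rule cINF_lower[OF _ q(1)])
        show "bdd_below ((\<lambda>q. if h \<sigma> \<le> q then max q (- \<bar>b\<bar>) else \<bar>b\<bar>) ` \<rat>)"
          by (rule bdd_belowI2[of _ "- \<bar>b\<bar>"]) auto
      qed
      also have "\<dots> \<le> y" using q bb by auto
      finally show ?thesis .
    qed
    then have "w (g \<sigma>) \<le> h \<sigma>" by (rule dense_ge)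
    ultimately have "w (g \<sigma>) = h \<sigma>" by simp
    then show "v (g \<sigma>) = h \<sigma>" using bb by (auto simp: v_def)
  qed
qed

lemma Borel_factor_complex:
  fixes K Z :: "(nat \<Rightarrow> nat) set" and h :: "(nat \<Rightarrow> nat) \<Rightarrow> complex"
  assumes T: "Hausdorff_space T" and g: "continuous_map (top_of_set K) T g"
    and Z: "Z \<in> sets borel" "Z \<subseteq> K"
    and h[measurable]: "h \<in> borel_measurable (restrict_space borel Z)"
    and b: "\<And>\<sigma>. \<sigma> \<in> Z \<Longrightarrow> norm (h \<sigma>) \<le> b"
    and fac: "\<And>\<sigma> \<tau>. \<sigma> \<in> Z \<Longrightarrow> \<tau> \<in> Z \<Longrightarrow> g \<sigma> = g \<tau> \<Longrightarrow> h \<sigma> = h \<tau>"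
  shows "\<exists>v\<in>borel_measurable (borel_of T). bounded (range v) \<and> (\<forall>\<sigma>\<in>Z. v (g \<sigma>) = h \<sigma>)"
proof -
  have b2: "\<bar>Re (h \<sigma>)\<bar> \<le> b" "\<bar>Im (h \<sigma>)\<bar> \<le> b" if "\<sigma> \<in> Z" for \<sigma>
    using b[OF that] abs_Re_le_cmod abs_Im_le_cmod order_trans by blast+
  have m2: "(\<lambda>\<sigma>. Re (h \<sigma>)) \<in> borel_measurable (restrict_space borel Z)"
    "(\<lambda>\<sigma>. Im (h \<sigma>)) \<in> borel_measurable (restrict_space borel Z)" by measurable
  have "Re (h \<sigma>) = Re (h \<tau>)" "Im (h \<sigma>) = Im (h \<tau>)" if "\<sigma> \<in> Z" "\<tau> \<in> Z" "g \<sigma> = g \<tau>" for \<sigma> \<tau>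
    using fac[OF that] by simp_all
  note fac2 = this
  have "\<exists>v\<in>borel_measurable (borel_of T). (\<forall>x. \<bar>v x\<bar> \<le> \<bar>b\<bar>) \<and> (\<forall>\<sigma>\<in>Z. v (g \<sigma>) = Re (h \<sigma>))"
    by (rule Borel_factor_real[OF T g Z m2(1) b2(1) fac2(1)])
  then   obtain v where v: "v \<in> borel_measurable (borel_of T)" "\<forall>x. \<bar>v x\<bar> \<le> \<bar>b\<bar>" "\<forall>\<sigma>\<in>Z. v (g \<sigma>) = Re (h \<sigma>)"
    by (elim bexE conjE)
  have "\<exists>w\<in>borel_measurable (borel_of T). (\<forall>x. \<bar>w x\<bar> \<le> \<bar>b\<bar>) \<and> (\<forall>\<sigma>\<in>Z. w (g \<sigma>) = Im (h \<sigma>))"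
    by (rule Borel_factor_real[OF T g Z m2(2) b2(2) fac2(2)])
  then   obtain w where w: "w \<in> borel_measurable (borel_of T)" "\<forall>x. \<bar>w x\<bar> \<le> \<bar>b\<bar>" "\<forall>\<sigma>\<in>Z. w (g \<sigma>) = Im (h \<sigma>)"
    by (elim bexE conjE)
  show ?thesis
  proof (intro bexI[of _ "\<lambda>x. Complex (v x) (w x)"] conjI ballI)
    show "(\<lambda>x. Complex (v x) (w x)) \<in> borel_measurable (borel_of T)"
      using v(1) w(1) by (subst borel_measurable_complex_iff) simp
    have "norm (Complex (v x) (w x)) \<le> \<bar>b\<bar> + \<bar>b\<bar>" for x
      using cmod_le[of "Complex (v x) (w x)"] v(2)[rule_format, of x] w(2)[rule_format, of x] by simp
    then show "bounded (range (\<lambda>x. Complex (v x) (w x)))"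
      unfolding bounded_iff by blast
  qed (use v w in \<open>auto simp: complex_eq_iff\<close>)
qed

section \<open>Polish spaces\<close>

lemma Polish_Hausdorff: "Polish_space T \<Longrightarrow> Hausdorff_space T"
  unfolding Polish_space_def
  by (auto intro: metrizable_imp_Hausdorff_space completely_metrizable_imp_metrizable_space)

lemma Polish_dense_sequence:
  fixes T :: "'a topology"
  assumes "Polish_space T" "topspace T \<noteq> {}"
  shows "\<exists>(d :: 'a \<Rightarrow> 'a \<Rightarrow> real) (q :: nat \<Rightarrow> 'a). Metric_space (topspace T) d
    \<and> Metric_space.mcomplete (topspace T) d \<and> T = Metric_space.mtopology (topspace T) d
    \<and> (\<forall>a. q a \<in> topspace T) \<and> (\<forall>x\<in>topspace T. \<forall>\<epsilon>>0. \<exists>a. d (q a) x < \<epsilon>)"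
proof -
  from assms obtain M and d :: "'a \<Rightarrow> 'a \<Rightarrow> real" where MS: "Metric_space M d"
    and comp: "Metric_space.mcomplete M d" and T: "T = Metric_space.mtopology M d"
    unfolding Polish_space_def completely_metrizable_space_def by blast
  interpret Metric_space M d by (rule MS)
  have M: "topspace T = M" by (simp only: T topspace_mtopology)
  obtain Q where Q: "countable Q" "Q \<subseteq> M" "T closure_of Q = M"
    using assms unfolding Polish_space_def separable_space_def M by blast
  then have "Q \<noteq> {}" using assms(2) M by auto
  then obtain q :: "nat \<Rightarrow> 'a" where q: "range q = Q"
    using Q(1) by (metis range_from_nat_into)
  have "\<exists>a. d (q a) x < \<epsilon>" if "x \<in> M" "\<epsilon> > 0" for x \<epsilon>
  proof -
    have "x \<in> T closure_of Q" using that Q(3) by simp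
    then have "\<exists>y. y \<in> Q \<and> y \<in> mball x \<epsilon>"
      using that(2) by (auto simp: T metric_closure_of)
    then show ?thesis using q by (auto simp: commute)
  qed
  then show ?thesis
    unfolding M using MS comp T Q(2) q by (intro exI[of _ d] exI[of _ q]) auto
qed

text \<open>A sequence \<open>\<sigma>\<close> of indices into a dense sequence \<open>q\<close> codes the limit of \<open>q (\<sigma> k)\<close>. Only codes with a
prescribed rate of convergence are admitted: they form a closed set, the limit depends
continuously on them, and every point has one.\<close>
lemma Polish_continuous_image:
  fixes T :: "'a topology"
  assumes "Polish_space T"
  shows "\<exists>(C :: (nat \<Rightarrow> nat) set) g. closed C \<and> continuous_map (top_of_set C) T g \<and> g ` C = topspace T"
proof (cases "topspace T = {}")
  case True
  then show ?thesis
    by (intro exI[of _ "{}"] exI[of _ "\<lambda>_. undefined"]) (auto simp: continuous_map_def)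
next
  case False
  from Polish_dense_sequence[OF assms this]
  obtain d :: "'a \<Rightarrow> 'a \<Rightarrow> real" and q :: "nat \<Rightarrow> 'a" where MS: "Metric_space (topspace T) d"
    and comp: "Metric_space.mcomplete (topspace T) d" and T: "T = Metric_space.mtopology (topspace T) d"
    and qM: "\<forall>a. q a \<in> topspace T" and dense0: "\<forall>x\<in>topspace T. \<forall>\<epsilon>>0. \<exists>a. d (q a) x < \<epsilon>"
    by (elim exE conjE)
  define M where "M = topspace T"
  have T: "T = Metric_space.mtopology M d" using T by (simp only: M_def)
  interpret Metric_space M d using MS by (simp only: M_def)
  have comp: "mcomplete" and qM: "q a \<in> M" for a using comp qM by (simp_all only: M_def)
  have dense: "\<exists>a. d (q a) x \<le> (1/2) ^ k" if "x \<in> M" for x k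
  proof -
    have "\<exists>a. d (q a) x < (1/2) ^ k" using dense0 that by (simp add: M_def)
    then show ?thesis by (auto intro: less_imp_le)
  qed
  define C where "C = {\<sigma> :: nat \<Rightarrow> nat. \<forall>k l. d (q (\<sigma> k)) (q (\<sigma> l)) \<le> (1/2) ^ k + (1/2) ^ l}"
  have "closed C"
    unfolding C_def
  proof (intro closed_Collect_all)
    fix k l
    let ?P = "\<lambda>a b. d (q a) (q b) \<le> (1/2) ^ k + (1/2) ^ l"
    have "open (\<Union>(a, b)\<in>{(a, b). \<not> ?P a b}. {\<sigma> :: nat \<Rightarrow> nat. \<sigma> k = a} \<inter> {\<sigma>. \<sigma> l = b})"
      by (intro open_UN ballI) (auto intro!: open_Int open_coordinate)
    moreover have "(\<Union>(a, b)\<in>{(a, b). \<not> ?P a b}. {\<sigma> :: nat \<Rightarrow> nat. \<sigma> k = a} \<inter> {\<sigma>. \<sigma> l = b})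
        = - {\<sigma>. ?P (\<sigma> k) (\<sigma> l)}" by auto
    ultimately show "closed {\<sigma>. ?P (\<sigma> k) (\<sigma> l)}" by (simp add: closed_def)
  qed
  have lim: "\<exists>x\<in>M. \<forall>k. d (q (\<sigma> k)) x \<le> (1/2) ^ k" if \<sigma>: "\<sigma> \<in> C" for \<sigma>
  proof -
    have "MCauchy (q \<circ> \<sigma>)"
      unfolding MCauchy_def
    proof (intro conjI allI impI)
      show "range (q \<circ> \<sigma>) \<subseteq> M" using qM by auto
      fix \<epsilon> :: real assume "\<epsilon> > 0"
      then obtain N where N: "(1/2) ^ N < \<epsilon> / 2"
        using real_arch_pow_inv[of "\<epsilon> / 2" "1/2"] by auto
      show "\<exists>N. \<forall>n n'. N \<le> n \<longrightarrow> N \<le> n' \<longrightarrow> d ((q \<circ> \<sigma>) n) ((q \<circ> \<sigma>) n') < \<epsilon>"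
      proof (intro exI allI impI)
        fix n m assume nm: "N \<le> n" "N \<le> m"
        have "d (q (\<sigma> n)) (q (\<sigma> m)) \<le> (1/2) ^ n + (1/2) ^ m" using \<sigma> by (auto simp: C_def)
        moreover have "(1/2 :: real) ^ n \<le> (1/2) ^ N" "(1/2 :: real) ^ m \<le> (1/2) ^ N"
          using nm by (auto intro: power_decreasing)
        ultimately have "d (q (\<sigma> n)) (q (\<sigma> m)) < \<epsilon>" using N by linarith
        then show "d ((q \<circ> \<sigma>) n) ((q \<circ> \<sigma>) m) < \<epsilon>" by simp
      qed
    qed
    then obtain x where x: "limitin mtopology (q \<circ> \<sigma>) x sequentially"
      using comp unfolding mcomplete_def by blast
    then have xM: "x \<in> M" using limitin_mspace by blast
    have "d (q (\<sigma> k)) x \<le> (1/2) ^ k" for k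
    proof (rule field_le_epsilon)
      fix \<epsilon> :: real assume e: "\<epsilon> > 0"
      then obtain N1 where N1: "\<And>n. n \<ge> N1 \<Longrightarrow> d (q (\<sigma> n)) x < \<epsilon> / 2"
        using x[unfolded limitin_metric] by (fastforce simp: eventually_sequentially dest: spec[of _ "\<epsilon> / 2"])
      obtain N2 where N2: "(1/2) ^ N2 < \<epsilon> / 2"
        using real_arch_pow_inv[of "\<epsilon> / 2" "1/2"] e by auto
      define n where "n = max N1 N2"
      have "(1/2 :: real) ^ n \<le> (1/2) ^ N2" unfolding n_def by (intro power_decreasing) auto
      moreover have "d (q (\<sigma> n)) x < \<epsilon> / 2" by (rule N1) (simp add: n_def)
      moreover have "d (q (\<sigma> k)) (q (\<sigma> n)) \<le> (1/2) ^ k + (1/2) ^ n" using \<sigma> by (auto simp: C_def)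
      moreover have "d (q (\<sigma> k)) x \<le> d (q (\<sigma> k)) (q (\<sigma> n)) + d (q (\<sigma> n)) x"
        using triangle qM xM by blast
      ultimately show "d (q (\<sigma> k)) x \<le> (1/2) ^ k + \<epsilon>" using N2 by linarith
    qed
    then show ?thesis using xM by blast
  qed
  then obtain g where gM: "\<And>\<sigma>. \<sigma> \<in> C \<Longrightarrow> g \<sigma> \<in> M"
    and g: "\<And>\<sigma> k. \<sigma> \<in> C \<Longrightarrow> d (q (\<sigma> k)) (g \<sigma>) \<le> (1/2) ^ k"
    by metis
  have "continuous_map (top_of_set C) T g"
    unfolding continuous_map_def
  proof (intro conjI allI impI)
    show "g \<in> topspace (top_of_set C) \<rightarrow> topspace T" using gM by (simp add: M_def)
    fix U assume "openin T U"
    show "openin (top_of_set C) {\<sigma> \<in> topspace (top_of_set C). g \<sigma> \<in> U}"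
    proof (subst openin_subopen, intro ballI)
      fix \<sigma> assume "\<sigma> \<in> {\<sigma> \<in> topspace (top_of_set C). g \<sigma> \<in> U}"
      then have \<sigma>: "\<sigma> \<in> C" "g \<sigma> \<in> U" by auto
      obtain r where r: "r > 0" "mball (g \<sigma>) r \<subseteq> U"
        using \<open>openin T U\<close> \<sigma>(2) unfolding T openin_mtopology by blast
      then obtain k where k: "(1/2) ^ k < r / 2"
        using real_arch_pow_inv[of "r / 2" "1/2"] by auto
      have "g \<tau> \<in> U" if "\<tau> \<in> C" "\<tau> k = \<sigma> k" for \<tau>
      proof -
        have "d (g \<sigma>) (g \<tau>) \<le> d (g \<sigma>) (q (\<sigma> k)) + d (q (\<sigma> k)) (g \<tau>)"
          using triangle gM \<sigma>(1) that(1) qM by blast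
        also have "\<dots> < r"
          using g[OF \<sigma>(1), of k] g[OF that(1), of k] that(2) k by (simp add: commute)
        finally show ?thesis using r(2) gM \<sigma>(1) that(1) by (auto simp: in_mball)
      qed
      then show "\<exists>V. openin (top_of_set C) V \<and> \<sigma> \<in> V
          \<and> V \<subseteq> {\<sigma> \<in> topspace (top_of_set C). g \<sigma> \<in> U}"
        using \<sigma>(1) open_coordinate[of "\<lambda>a. a = \<sigma> k" k]
        by (intro exI[of _ "C \<inter> {\<tau>. \<tau> k = \<sigma> k}"]) auto
    qed
  qed
  moreover have "g ` C = topspace T"
  proof (intro equalityI subsetI)
    fix x assume "x \<in> topspace T"
    then have xM: "x \<in> M" by (simp add: M_def)
    then obtain \<sigma> where \<sigma>: "\<And>k. d (q (\<sigma> k)) x \<le> (1/2) ^ k" using dense by metis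
    have "\<sigma> \<in> C"
      unfolding C_def
    proof (intro CollectI allI)
      fix k l
      have "d (q (\<sigma> k)) (q (\<sigma> l)) \<le> d (q (\<sigma> k)) x + d x (q (\<sigma> l))"
        using triangle qM xM by blast
      then show "d (q (\<sigma> k)) (q (\<sigma> l)) \<le> (1/2) ^ k + (1/2) ^ l"
        using \<sigma>[of k] \<sigma>[of l] by (simp add: commute)
    qed
    moreover have "g \<sigma> = x"
    proof (rule ccontr)
      assume "g \<sigma> \<noteq> x"
      then have "d (g \<sigma>) x > 0" using gM[OF \<open>\<sigma> \<in> C\<close>] xM by simp
      then obtain k where k: "(1/2) ^ k < d (g \<sigma>) x / 2"
        using real_arch_pow_inv[of "d (g \<sigma>) x / 2" "1/2"] by auto
      have "d (g \<sigma>) x \<le> d (g \<sigma>) (q (\<sigma> k)) + d (q (\<sigma> k)) x"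
        using triangle gM[OF \<open>\<sigma> \<in> C\<close>] qM xM by blast
      then show False using g[OF \<open>\<sigma> \<in> C\<close>, of k] \<sigma>[of k] k by (simp add: commute)
    qed
    ultimately show "x \<in> g ` C" by blast
  qed (use gM in \<open>auto simp: M_def\<close>)
  ultimately show ?thesis using \<open>closed C\<close> by (intro exI[of _ C] exI[of _ g] conjI)
qed

text \<open>Countably many open sets that distinguish points make equality of two measurable maps a
measurable condition.\<close>
lemma Polish_separating_sequence:
  fixes T :: "'a topology"
  assumes "Polish_space T"
  shows "\<exists>U :: nat \<times> nat \<Rightarrow> 'a set. (\<forall>m. openin T (U m)) \<and>
    (\<forall>x\<in>topspace T. \<forall>y\<in>topspace T. (\<forall>m. x \<in> U m \<longleftrightarrow> y \<in> U m) \<longrightarrow> x = y)"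
proof (cases "topspace T = {}")
  case True
  then show ?thesis by (intro exI[of _ "\<lambda>_. {}"]) simp
next
  case False
  from Polish_dense_sequence[OF assms this]
  obtain d :: "'a \<Rightarrow> 'a \<Rightarrow> real" and q :: "nat \<Rightarrow> 'a" where MS: "Metric_space (topspace T) d"
    and T: "T = Metric_space.mtopology (topspace T) d"
    and qM: "\<forall>a. q a \<in> topspace T" and dense: "\<forall>x\<in>topspace T. \<forall>\<epsilon>>0. \<exists>a. d (q a) x < \<epsilon>"
    by (elim exE conjE)
  define M where "M = topspace T"
  have T: "T = Metric_space.mtopology M d" using T by (simp only: M_def)
  interpret Metric_space M d using MS by (simp only: M_def)
  define U where "U = (\<lambda>(a, k). mball (q a) ((1/2) ^ k))"
  have "x = y" if xy: "x \<in> M" "y \<in> M" and eq: "\<forall>m. x \<in> U m \<longleftrightarrow> y \<in> U m" for x y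
  proof (rule ccontr)
    assume "x \<noteq> y"
    then have "d x y / 2 > 0" using xy by simp
    then obtain k where k: "(1/2) ^ k < d x y / 2"
      using real_arch_pow_inv[of "d x y / 2" "1/2"] by auto
    obtain a where a: "d (q a) x < (1/2) ^ k" using dense xy(1) unfolding M_def by fastforce
    have qa: "q a \<in> M" using qM by (simp add: M_def)
    have "x \<in> U (a, k)" using a qa xy(1) by (simp add: U_def)
    then have "y \<in> U (a, k)" using eq by simp
    then have "d (q a) y < (1/2) ^ k" by (simp add: U_def)
    moreover have "d x y \<le> d x (q a) + d (q a) y" using xy qa by (intro triangle)
    ultimately show False using a k by (simp add: commute)
  qed
  moreover have "openin T (U m)" for m by (cases m) (simp add: U_def T)
  ultimately show ?thesis by (intro exI[of _ U]) (simp add: M_def)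
qed

lemma Polish_equal_measurable:
  fixes T :: "'a topology"
  assumes "Polish_space T"
    and [measurable]: "a \<in> measurable M (borel_of T)" "b \<in> measurable M (borel_of T)"
  shows "{x \<in> space M. a x = b x} \<in> sets M"
proof -
  from Polish_separating_sequence[OF assms(1)]
  obtain U :: "nat \<times> nat \<Rightarrow> 'a set" where U: "\<forall>m. openin T (U m)"
    "\<forall>x\<in>topspace T. \<forall>y\<in>topspace T. (\<forall>m. x \<in> U m \<longleftrightarrow> y \<in> U m) \<longrightarrow> x = y"
    by (elim exE conjE)
  have [measurable]: "U m \<in> sets (borel_of T)" for m using U(1)[rule_format, of m] by (rule borel_of_openin)
  have "a x \<in> topspace T" "b x \<in> topspace T" if "x \<in> space M" for x
    using measurable_space[OF assms(2) that] measurable_space[OF assms(3) that] by auto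
  then have "{x \<in> space M. a x = b x} = {x \<in> space M. \<forall>m. a x \<in> U m \<longleftrightarrow> b x \<in> U m}"
    using U(2) by auto
  also have "\<dots> \<in> sets M" by measurable
  finally show ?thesis .
qed

lemma continuous_map_Borel:
  fixes K :: "'b::topological_space set"
  assumes "continuous_map (top_of_set K) T g"
  shows "g \<in> measurable (restrict_space borel K) (borel_of T)"
  unfolding borel_of_def
proof (rule measurable_measure_of)
  show "g \<in> space (restrict_space borel K) \<rightarrow> topspace T"
    using assms by (auto simp: continuous_map_def space_restrict_space)
  fix U assume "U \<in> {U. openin T U}"
  then have "openin (top_of_set K) {x \<in> topspace (top_of_set K). g x \<in> U}"
    using openin_continuous_map_preimage[OF assms, of U] by simp
  then obtain V where "open V" "{x \<in> K. g x \<in> U} = K \<inter> V"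
    by (auto simp: openin_open)
  then have "g -` U \<inter> space (restrict_space borel K) = K \<inter> V" "V \<in> sets borel"
    by (auto simp: space_restrict_space)
  then show "g -` U \<inter> space (restrict_space borel K) \<in> sets (restrict_space borel K)"
    by (auto simp: sets_restrict_space)
qed (auto dest: openin_subset)

section \<open>Finite full sets\<close>

text \<open>This is where fullness enters. Replacing in \<open>w\<close> the \<open>i\<close>-th coordinate by that of \<open>x\<close> gives a point
\<open>v\<close> of the same box. Were evaluation of coordinate sums at \<open>v\<close> not a linear combination of the
evaluations at the points of \<open>F\<close>, some coordinate sum would vanish on \<open>F\<close> and not at \<open>v\<close>; then
\<open>F\<close> together with \<open>v\<close> would still be good, against maximality. So it is one, and subtracting the
evaluation at \<open>w\<close> isolates the \<open>i\<close>-th summand.\<close>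
lemma full_coordinate_combination:
  fixes F :: "(nat \<Rightarrow> 'a) set"
  assumes "finite F" "full n F" "x \<in> F" "w \<in> F" "i \<in> {1..n}"
  shows "\<exists>c :: (nat \<Rightarrow> 'a) \<Rightarrow> complex. \<forall>u.
    (\<Sum>y\<in>F. c y * (\<Sum>k\<in>{1..n}. u k (y k))) = u i (x i) - u i (w i)"
proof -
  let ?s = "\<lambda>u :: nat \<Rightarrow> 'a \<Rightarrow> complex. \<lambda>y. \<Sum>k\<in>{1..n}. u k (y k)"
  have good: "good n F" and maxi: "\<And>T. good n T \<Longrightarrow> F \<subset> T \<Longrightarrow> T \<subseteq> proj_box n F \<Longrightarrow> False"
    and box: "F \<subseteq> proj_box n F"
    using assms(2) unfolding full_def by blast+
  let ?v = "w(i := x i)"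
  have s_v: "?s u ?v = ?s u w + (u i (x i) - u i (w i))" for u
  proof -
    have "?s u ?v = u i (x i) + (\<Sum>k\<in>{1..n} - {i}. u k (w k))"
      using assms(5) by (subst sum.remove[of _ i]) (auto intro!: sum.cong)
    moreover have "?s u w = u i (w i) + (\<Sum>k\<in>{1..n} - {i}. u k (w k))"
      using assms(5) by (subst sum.remove[of _ i]) auto
    ultimately show ?thesis by simp
  qed
  have "\<exists>c. \<forall>u. (\<Sum>y\<in>F. c y * ?s u y) = ?s u ?v"
  proof (cases "?v \<in> F")
    case True
    show ?thesis
    proof (intro exI allI)
      fix u
      have "(\<Sum>y\<in>F. (if y = ?v then 1 else 0) * ?s u y) = (\<Sum>y\<in>F. if y = ?v then ?s u y else 0)"
        by (intro sum.cong) auto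
      also have "\<dots> = ?s u ?v" using True assms(1) by (subst sum.delta) auto
      finally show "(\<Sum>y\<in>F. (if y = ?v then 1 else 0) * ?s u y) = ?s u ?v" .
    qed
  next
    case False
    have "w \<in> proj_box n F" using box assms(4) by blast
    then have "?v \<in> proj_box n F"
      using assms(3,5) by (auto simp: proj_box_def PiE_iff extensional_def)
    then have "\<not> good n (insert ?v F)"
      using maxi[of "insert ?v F"] False box by blast
    have "\<exists>u. \<forall>z\<in>F. (if z = y then 1 else 0) = ?s u z" for y
      using good[unfolded good_def, THEN spec, of "\<lambda>z. if z = y then 1 else 0"] .
    then have "\<forall>y. \<exists>u. \<forall>z\<in>F. (if z = y then 1 else 0) = ?s u z" ..
    then obtain e where "\<forall>y. \<forall>z\<in>F. (if z = y then 1 else 0) = ?s (e y) z"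
      by (rule choice[THEN exE])
    then have e: "?s (e y) z = (if z = y then 1 else 0)" if "z \<in> F" for y z
      using that by simp
    have "(\<Sum>y\<in>F. ?s (e y) ?v * ?s u y) = ?s u ?v" for u
    proof (rule ccontr)
      assume neq: "(\<Sum>y\<in>F. ?s (e y) ?v * ?s u y) \<noteq> ?s u ?v"
      \<comment> \<open>The families \<open>e y\<close> are dual to the points of \<open>F\<close>, so removing these components makes the sum vanish on \<open>F\<close>.\<close>
      define r where "r = (\<lambda>k a. u k a - (\<Sum>y\<in>F. ?s u y * e y k a))"
      have s_r: "?s r z = ?s u z - (\<Sum>y\<in>F. ?s u y * ?s (e y) z)" for z
      proof -
        have "?s r z = ?s u z - (\<Sum>k\<in>{1..n}. \<Sum>y\<in>F. ?s u y * e y k (z k))"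
          unfolding r_def by (rule sum_subtractf)
        also have "(\<Sum>k\<in>{1..n}. \<Sum>y\<in>F. ?s u y * e y k (z k)) = (\<Sum>y\<in>F. ?s u y * ?s (e y) z)"
          by (subst sum.swap) (simp only: sum_distrib_left)
        finally show ?thesis .
      qed
      have r0: "?s r z = 0" if "z \<in> F" for z
      proof -
        have "(\<Sum>y\<in>F. ?s u y * ?s (e y) z) = (\<Sum>y\<in>F. if y = z then ?s u y else 0)"
          using e[OF that] by (intro sum.cong) auto
        also have "\<dots> = ?s u z" using that assms(1) by (subst sum.delta) auto
        finally show ?thesis using s_r[of z] by simp
      qed
      have r1: "?s r ?v \<noteq> 0"
        using neq s_r[of ?v] by (simp add: mult.commute)
      have "good n (insert ?v F)"
        unfolding good_def
      proof
        fix f :: "(nat \<Rightarrow> 'a) \<Rightarrow> complex"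
        from good[unfolded good_def, THEN spec, of f]
        obtain p where p': "\<forall>z\<in>F. f z = ?s p z" by (rule exE)
        have p: "f z = ?s p z" if "z \<in> F" for z using p' that ..
        define a where "a = (f ?v - ?s p ?v) / ?s r ?v"
        have add: "?s (\<lambda>k t. p k t + a * r k t) z = ?s p z + a * ?s r z" for z
          by (simp only: sum.distrib sum_distrib_left)
        have "f z = ?s (\<lambda>k t. p k t + a * r k t) z" if "z \<in> insert ?v F" for z
        proof (cases "z \<in> F")
          case True
          then show ?thesis unfolding add using p[OF True] r0[OF True] by simp
        next
          case False
          then have "z = ?v" using that by blast
          have "a * ?s r ?v = f ?v - ?s p ?v" unfolding a_def using r1 by (rule nonzero_eq_divide_eq[THEN iffD1, OF _ refl])
          then show ?thesis unfolding add \<open>z = ?v\<close> by (simp only: add.commute[of "?s p ?v"] diff_add_cancel)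
        qed
        then show "\<exists>u. \<forall>z\<in>insert ?v F. f z = ?s u z"
          by (intro exI[of _ "\<lambda>k t. p k t + a * r k t"] ballI)
      qed
      with \<open>\<not> good n (insert ?v F)\<close> show False ..
    qed
    then show ?thesis by (intro exI[of _ "\<lambda>y. ?s (e y) ?v"] allI)
  qed
  then obtain c where c: "\<forall>u. (\<Sum>y\<in>F. c y * ?s u y) = ?s u ?v" by (rule exE)
  have "(\<Sum>y\<in>F. (c y - (if y = w then 1 else 0)) * ?s u y) = u i (x i) - u i (w i)" for u
  proof -
    have "(\<Sum>y\<in>F. (c y - (if y = w then 1 else 0)) * ?s u y)
        = (\<Sum>y\<in>F. c y * ?s u y) - (\<Sum>y\<in>F. if y = w then ?s u y else 0)"
      by (subst sum_subtractf[symmetric]) (intro sum.cong, auto simp: left_diff_distrib)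
    also have "(\<Sum>y\<in>F. if y = w then ?s u y else 0) = ?s u w"
      using assms(1,4) by (subst sum.delta) auto
    finally show ?thesis using c[rule_format, of u] s_v[of u] by simp
  qed
  then show ?thesis by (intro exI allI)
qed

text \<open>All that the identities below can see of a tuple of points: which of them agree in which
coordinate. For given \<open>n\<close> and \<open>N\<close> there are only finitely many such patterns.\<close>
definition pattern :: "nat \<Rightarrow> nat \<Rightarrow> (nat \<Rightarrow> nat \<Rightarrow> 'a) \<Rightarrow> (nat \<times> nat \<times> nat) set" where
  "pattern n N z = {(k, j, l). k \<in> {1..n} \<and> j < N \<and> l < N \<and> z j k = z l k}"

text \<open>The tuple \<open>z\<close> stands for a path from \<open>z 0\<close> to \<open>z 1\<close>; the identity expresses the change of the \<open>i\<close>-th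
summand along it by the values of the sum at the points of the tuple.\<close>
definition coordinate_identity ::
  "nat \<Rightarrow> nat \<Rightarrow> nat \<Rightarrow> (nat \<Rightarrow> complex) \<Rightarrow> (nat \<Rightarrow> nat \<Rightarrow> 'a) \<Rightarrow> bool" where
  "coordinate_identity n N i c z \<longleftrightarrow>
    (\<forall>u. (\<Sum>j<N. c j * (\<Sum>k\<in>{1..n}. u k (z j k))) = u i (z 1 i) - u i (z 0 i))"

text \<open>A family \<open>u\<close> on the coordinates of \<open>z'\<close> is carried over to the coordinates of \<open>z\<close> by matching
positions, which is unambiguous exactly because the patterns agree.\<close>
lemma coordinate_identity_pattern:
  fixes z z' :: "nat \<Rightarrow> nat \<Rightarrow> 'a"
  assumes "coordinate_identity n N i c z" "pattern n N z = pattern n N z'"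
    and "i \<in> {1..n}" "N \<ge> 2"
  shows "coordinate_identity n N i c z'"
  unfolding coordinate_identity_def
proof
  fix u :: "nat \<Rightarrow> 'a \<Rightarrow> complex"
  have pat: "z j k = z l k \<longleftrightarrow> z' j k = z' l k" if "k \<in> {1..n}" "j < N" "l < N" for j k l
  proof -
    have "(k, j, l) \<in> pattern n N z \<longleftrightarrow> (k, j, l) \<in> pattern n N z'" using assms(2) by simp
    then show ?thesis using that by (simp add: pattern_def)
  qed
  define p where "p k a = (SOME l. l < N \<and> z l k = a)" for k a
  define v where "v k a = u k (z' (p k a) k)" for k a
  have v: "v k (z j k) = u k (z' j k)" if "k \<in> {1..n}" "j < N" for j k
  proof -
    have "p k (z j k) < N \<and> z (p k (z j k)) k = z j k"
      unfolding p_def by (rule someI[of _ j]) (use that in simp)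
    then show ?thesis using pat[of k "p k (z j k)" j] that by (simp add: v_def)
  qed
  have "(\<Sum>j<N. c j * (\<Sum>k\<in>{1..n}. u k (z' j k))) = (\<Sum>j<N. c j * (\<Sum>k\<in>{1..n}. v k (z j k)))"
    by (intro sum.cong arg_cong2[of _ _ _ _ "(*)"]) (auto simp: v)
  also have "\<dots> = v i (z 1 i) - v i (z 0 i)"
    using assms(1) unfolding coordinate_identity_def by blast
  also have "\<dots> = u i (z' 1 i) - u i (z' 0 i)" using v assms(3,4) by simp
  finally show "(\<Sum>j<N. c j * (\<Sum>k\<in>{1..n}. u k (z' j k))) = u i (z' 1 i) - u i (z' 0 i)" .
qed

text \<open>Enumerating \<open>F\<close> in the positions from 2 on, and padding with \<open>x\<close>, gives tuples of one length for
all paths with at most \<open>L\<close> points, so that only finitely many patterns occur.\<close>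
lemma full_coordinate_identity:
  fixes F :: "(nat \<Rightarrow> 'a) set"
  assumes "finite F" "full n F" "x \<in> F" "w \<in> F" "i \<in> {1..n}" "card F \<le> L"
  shows "\<exists>z c. z 0 = w \<and> z 1 = x \<and> (\<forall>j<L + 2. z j \<in> F) \<and> coordinate_identity n (L + 2) i c z"
proof -
  from full_coordinate_combination[OF assms(1-5)]
  obtain c :: "(nat \<Rightarrow> 'a) \<Rightarrow> complex"
    where c: "\<forall>u. (\<Sum>y\<in>F. c y * (\<Sum>k\<in>{1..n}. u k (y k))) = u i (x i) - u i (w i)"
    by (rule exE)
  obtain e where e: "bij_betw e {0..<card F} F" using ex_bij_betw_nat_finite[OF assms(1)] by blast
  define z where "z = (\<lambda>j. if j = 0 then w else if j = 1 \<or> j \<ge> card F + 2 then x else e (j - 2))"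
  define J where "J = {2..<card F + 2}"
  have "bij_betw (\<lambda>j. j - 2) J {0..<card F}"
    unfolding J_def by (rule bij_betw_byWitness[of _ "\<lambda>j. j + 2"]) auto
  then have "bij_betw (e \<circ> (\<lambda>j. j - 2)) J F" using e by (rule bij_betw_trans)
  moreover have "(e \<circ> (\<lambda>j. j - 2)) j = z j" if "j \<in> J" for j
    using that by (auto simp: z_def J_def)
  ultimately have zJ: "bij_betw z J F" using bij_betw_cong by blast
  show ?thesis
  proof (intro exI conjI allI impI)
    show "z 0 = w" "z 1 = x" by (auto simp: z_def)
    show "z j \<in> F" for j
    proof (cases "j \<in> J")
      case True
      then show ?thesis using zJ bij_betwE by blast
    next
      case False
      then show ?thesis using assms(3,4) by (auto simp: z_def J_def)
    qed
    show "coordinate_identity n (L + 2) i (\<lambda>j. if j \<in> J then c (z j) else 0) z"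
      unfolding coordinate_identity_def
    proof
      fix u :: "nat \<Rightarrow> 'a \<Rightarrow> complex"
      let ?s = "\<lambda>y. \<Sum>k\<in>{1..n}. u k (y k)"
      have "(\<Sum>j<L+2. (if j \<in> J then c (z j) else 0) * ?s (z j)) = (\<Sum>j\<in>J. c (z j) * ?s (z j))"
        using assms(6) by (intro sum.mono_neutral_cong_right) (auto simp: J_def)
      also have "\<dots> = (\<Sum>y\<in>F. c y * ?s y)" by (rule sum.reindex_bij_betw[OF zJ])
      also have "\<dots> = u i (z 1 i) - u i (z 0 i)" using c by (simp add: z_def)
      finally show "(\<Sum>j<L+2. (if j \<in> J then c (z j) else 0) * ?s (z j)) = u i (z 1 i) - u i (z 0 i)" .
    qed
  qed
qed

section \<open>Borel dependence on one coordinate\<close>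

lemma measurable_prod_coordinate:
  assumes "a \<in> measurable M (prod_space n X)" "k \<in> {1..n}"
  shows "(\<lambda>\<sigma>. a \<sigma> k) \<in> measurable M (borel_of (X k))"
  using assms(1) measurable_component_singleton[OF assms(2)] unfolding prod_space_def
  by (rule measurable_compose)

lemma prod_space_coordinate:
  assumes "S \<in> sets (prod_space n X)" "x \<in> S" "k \<in> {1..n}"
  shows "x k \<in> topspace (X k)"
proof -
  have "x \<in> (\<Pi>\<^sub>E k\<in>{1..n}. topspace (X k))"
    using sets.sets_into_space[OF assms(1)] assms(2) by (auto simp: prod_space_def space_PiM)
  then show ?thesis using assms(3) by (rule PiE_mem)
qed

lemma prod_space_extensional:
  assumes "S \<in> sets (prod_space n X)" "x \<in> S"
  shows "x \<in> extensional {1..n}"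
proof -
  have "x \<in> (\<Pi>\<^sub>E k\<in>{1..n}. topspace (X k))"
    using sets.sets_into_space[OF assms(1)] assms(2) by (auto simp: prod_space_def space_PiM)
  then show ?thesis by (simp add: PiE_iff)
qed

lemma pattern_alt:
  "pattern n N z = {t \<in> {1..n} \<times> {..<N} \<times> {..<N}. z (fst (snd t)) (fst t) = z (snd (snd t)) (fst t)}"
  by (auto simp: pattern_def)

lemma Collect_eq_iff_on: "Q \<subseteq> I \<Longrightarrow> {t \<in> I. R t} = Q \<longleftrightarrow> (\<forall>t\<in>I. R t \<longleftrightarrow> t \<in> Q)"
  by blast

lemma pattern_measurable:
  fixes X :: "nat \<Rightarrow> 'a topology" and z :: "'b \<Rightarrow> nat \<Rightarrow> nat \<Rightarrow> 'a"
  assumes P: "\<And>k. k \<in> {1..n} \<Longrightarrow> Polish_space (X k)"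
    and z: "\<And>j. j < N \<Longrightarrow> (\<lambda>\<sigma>. z \<sigma> j) \<in> measurable M (prod_space n X)"
  shows "(\<lambda>\<sigma>. pattern n N (z \<sigma>)) \<in> measurable M (count_space (Pow ({1..n} \<times> {..<N} \<times> {..<N})))"
proof -
  let ?I = "{1..n} \<times> {..<N} \<times> {..<N}"
  have eq: "{\<sigma> \<in> space M. z \<sigma> j k = z \<sigma> l k} \<in> sets M" if "k \<in> {1..n}" "j < N" "l < N" for j k l
    using Polish_equal_measurable[OF P[OF that(1)] measurable_prod_coordinate[OF z[OF that(2)] that(1)]
        measurable_prod_coordinate[OF z[OF that(3)] that(1)]] .
  have "(\<lambda>\<sigma>. pattern n N (z \<sigma>)) -` {Q} \<inter> space M \<in> sets M" if "Q \<in> Pow ?I" for Q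
  proof -
    have "pattern n N (z \<sigma>) = Q \<longleftrightarrow> (\<forall>t\<in>?I. z \<sigma> (fst (snd t)) (fst t) = z \<sigma> (snd (snd t)) (fst t) \<longleftrightarrow> t \<in> Q)" for \<sigma>
      unfolding pattern_alt by (rule Collect_eq_iff_on[OF PowD[OF that]])
    then have "(\<lambda>\<sigma>. pattern n N (z \<sigma>)) -` {Q} \<inter> space M
        = {\<sigma> \<in> space M. \<forall>t\<in>?I. z \<sigma> (fst (snd t)) (fst t) = z \<sigma> (snd (snd t)) (fst t) \<longleftrightarrow> t \<in> Q}"
      by (simp add: vimage_def Int_def conj_commute)
    also have "\<dots> \<in> sets M"
    proof (rule sets.sets_Collect_finite_All)
      fix t assume "t \<in> ?I"
      then have "fst t \<in> {1..n}" "fst (snd t) < N" "snd (snd t) < N"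
        by (simp_all only: mem_Times_iff lessThan_iff)
      note eq_t = eq[OF this]
      show "{\<sigma> \<in> space M. z \<sigma> (fst (snd t)) (fst t) = z \<sigma> (snd (snd t)) (fst t) \<longleftrightarrow> t \<in> Q} \<in> sets M"
      proof (cases "t \<in> Q")
        case True
        then show ?thesis using eq_t by simp
      next
        case False
        then show ?thesis
          using sets.sets_Collect_neg[OF eq_t] by simp
      qed
    qed simp
    finally show ?thesis .
  qed
  moreover have "pattern n N (z \<sigma>) \<in> Pow ?I" for \<sigma>
    by (auto simp: pattern_def)
  ultimately show ?thesis
    by (simp only: measurable_count_space_eq2 finite_Pow_iff finite_cartesian_product
        finite_atLeastAtMost finite_lessThan simp_thms Pi_iff) simp
qed

text \<open>The set \<open>Z\<close> consists of sequences \<open>\<sigma>\<close> that code a tuple \<open>z \<sigma>\<close> in \<open>S\<close> starting at \<open>w\<close> whose pattern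
admits coefficients for a coordinate identity. With one choice of coefficients per pattern, the
change of \<open>u i\<close> along the tuple becomes a Borel function \<open>h\<close> on \<open>Z\<close>, bounded because there are
finitely many patterns. It depends only on the \<open>i\<close>-th coordinate of \<open>z \<sigma> 1\<close>, hence factors through a
Borel function on \<open>X i\<close>; and every point of \<open>S\<close> occurs as some \<open>z \<sigma> 1\<close>.\<close>
lemma coordinate_function_Borel:
  fixes n N i :: nat and X :: "nat \<Rightarrow> 'a topology" and S :: "(nat \<Rightarrow> 'a) set"
    and f :: "(nat \<Rightarrow> 'a) \<Rightarrow> complex" and u :: "nat \<Rightarrow> 'a \<Rightarrow> complex"
  assumes P: "\<And>k. k \<in> {1..n} \<Longrightarrow> Polish_space (X k)"
    and S: "S \<in> sets (prod_space n X)" and w: "w \<in> S" and i: "i \<in> {1..n}" and N: "N \<ge> 2"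
    and f: "f \<in> borel_measurable (restrict_space (prod_space n X) S)" "bounded (f ` S)"
    and u: "\<forall>x\<in>S. f x = (\<Sum>k\<in>{1..n}. u k (x k))"
    and path: "\<And>x. x \<in> S \<Longrightarrow> \<exists>z c. z 0 = w \<and> z 1 = x \<and> (\<forall>j<N. z j \<in> S) \<and> coordinate_identity n N i c z"
  shows "\<exists>v\<in>borel_measurable (borel_of (X i)). bounded (range v) \<and> (\<forall>x\<in>S. v (x i) = u i (x i) - u i (w i))"
proof -
  have "\<forall>k\<in>{1..n}. \<exists>Cg. closed (fst Cg) \<and> continuous_map (top_of_set (fst Cg :: (nat \<Rightarrow> nat) set)) (X k) (snd Cg)
      \<and> snd Cg ` fst Cg = topspace (X k)"
  proof
    fix k assume "k \<in> {1..n}"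
    from Polish_continuous_image[OF P[OF this]]
    obtain C :: "(nat \<Rightarrow> nat) set" and g where "closed C" "continuous_map (top_of_set C) (X k) g" "g ` C = topspace (X k)"
      by (elim exE conjE)
    then show "\<exists>Cg. closed (fst Cg) \<and> continuous_map (top_of_set (fst Cg :: (nat \<Rightarrow> nat) set)) (X k) (snd Cg)
      \<and> snd Cg ` fst Cg = topspace (X k)" by (intro exI[of _ "(C, g)"]) simp
  qed
  then obtain Cg where Cg: "\<forall>k\<in>{1..n}. closed (fst (Cg k))
      \<and> continuous_map (top_of_set (fst (Cg k) :: (nat \<Rightarrow> nat) set)) (X k) (snd (Cg k))
      \<and> snd (Cg k) ` fst (Cg k) = topspace (X k)" by (rule bchoice[THEN exE])
  define C where "C = (\<lambda>k. fst (Cg k))"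
  define g where "g = (\<lambda>k. snd (Cg k))"
  have C: "closed (C k)" and g: "continuous_map (top_of_set (C k)) (X k) (g k)"
    and onto: "g k ` C k = topspace (X k)" if "k \<in> {1..n}" for k
    using Cg that by (simp_all add: C_def g_def)

  \<comment> \<open>One sequence packs a code of the \<open>k\<close>-th coordinate of the \<open>j\<close>-th point for all \<open>j\<close> and \<open>k\<close>.\<close>
  define slot :: "nat \<Rightarrow> nat \<Rightarrow> (nat \<Rightarrow> nat) \<Rightarrow> nat \<Rightarrow> nat"
    where "slot = (\<lambda>j k \<sigma> m. \<sigma> (prod_encode (prod_encode (j, k), m)))"
  define K where "K = (\<Inter>j\<in>{..<N}. \<Inter>k\<in>{1..n}. slot j k -` C k)"
  define z where "z = (\<lambda>\<sigma> j. if j = 0 then w else (\<lambda>k\<in>{1..n}. g k (slot j k \<sigma>)))"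
  have slot_cont: "continuous_on A (slot j k)" for A j k
    unfolding slot_def by (rule continuous_on_reindex)
  have "closed K"
    unfolding K_def by (intro closed_INT ballI closed_vimage[OF C slot_cont])
  then have K: "K \<in> sets borel" by (rule borel_closed)
  have slot_map: "continuous_map (top_of_set K) (X k) (g k \<circ> slot j k)" if "j < N" "k \<in> {1..n}" for j k
  proof (rule continuous_map_compose[OF _ g[OF that(2)]])
    have "slot j k ` K \<subseteq> C k" using that unfolding K_def by auto
    then show "continuous_map (top_of_set K) (top_of_set (C k)) (slot j k)"
      using slot_cont by (simp add: continuous_map_in_subtopology image_subset_iff_funcset)
  qed

  define MK where "MK = restrict_space (borel :: (nat \<Rightarrow> nat) measure) K"
  have space_MK: "space MK = K" by (simp add: MK_def space_restrict_space)
  have z_meas: "(\<lambda>\<sigma>. z \<sigma> j) \<in> measurable MK (prod_space n X)" if "j < N" for j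
  proof (cases "j = 0")
    case True
    have "w \<in> space (prod_space n X)" using sets.sets_into_space[OF S] w by blast
    then show ?thesis using True by (simp add: z_def)
  next
    case False
    have "(\<lambda>\<sigma>. \<lambda>k\<in>{1..n}. g k (slot j k \<sigma>)) \<in> measurable MK (prod_space n X)"
      unfolding prod_space_def
    proof (rule measurable_restrict)
      fix k assume "k \<in> {1..n}"
      then show "(\<lambda>\<sigma>. g k (slot j k \<sigma>)) \<in> measurable MK (borel_of (X k))"
        using continuous_map_Borel[OF slot_map[OF that]] by (simp add: MK_def comp_def)
    qed
    then show ?thesis using False by (simp add: z_def)
  qed
  let ?I = "{1..n} \<times> {..<N} \<times> {..<N}"
  have pat_meas: "(\<lambda>\<sigma>. pattern n N (z \<sigma>)) \<in> measurable MK (count_space (Pow ?I))"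
    by (rule pattern_measurable[OF P z_meas])

  define valid where "valid = (\<lambda>Q c. \<forall>z :: nat \<Rightarrow> nat \<Rightarrow> 'a. pattern n N z = Q \<longrightarrow> coordinate_identity n N i c z)"
  define coef where "coef = (\<lambda>Q. SOME c. valid Q c)"
  define Z where "Z = {\<sigma> \<in> space MK. (\<forall>j\<in>{..<N}. z \<sigma> j \<in> S) \<and> pattern n N (z \<sigma>) \<in> {Q. \<exists>c. valid Q c}}"
  have "Z \<in> sets MK"
    unfolding Z_def
  proof (intro sets.sets_Collect_conj sets.sets_Collect_finite_All)
    show "{\<sigma> \<in> space MK. z \<sigma> j \<in> S} \<in> sets MK" if "j \<in> {..<N}" for j
    proof -
      have "(\<lambda>\<sigma>. z \<sigma> j) -` S \<inter> space MK \<in> sets MK"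
        using z_meas that S by (intro measurable_sets) auto
      moreover have "(\<lambda>\<sigma>. z \<sigma> j) -` S \<inter> space MK = {\<sigma> \<in> space MK. z \<sigma> j \<in> S}" by auto
      ultimately show ?thesis by simp
    qed
    let ?G = "{Q. \<exists>c. valid Q c} \<inter> Pow ?I"
    have "(\<lambda>\<sigma>. pattern n N (z \<sigma>)) -` ?G \<inter> space MK \<in> sets MK"
      by (rule measurable_sets[OF pat_meas]) simp
    moreover have "pattern n N (z \<sigma>) \<in> Pow ?I" for \<sigma> by (auto simp: pattern_def)
    then have "(\<lambda>\<sigma>. pattern n N (z \<sigma>)) -` ?G \<inter> space MK
        = {\<sigma> \<in> space MK. pattern n N (z \<sigma>) \<in> {Q. \<exists>c. valid Q c}}" by auto
    ultimately show "{\<sigma> \<in> space MK. pattern n N (z \<sigma>) \<in> {Q. \<exists>c. valid Q c}} \<in> sets MK" by simp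
  qed simp
  then have Z: "Z \<in> sets borel" "Z \<subseteq> K"
    using K by (simp_all add: MK_def sets_restrict_space_iff)
  have Z_S: "z \<sigma> j \<in> S" if "\<sigma> \<in> Z" "j < N" for \<sigma> j using that by (simp add: Z_def)

  have MZ: "restrict_space borel Z = restrict_space MK Z"
    unfolding MK_def using Z K by (subst restrict_restrict_space) (auto simp: Int_absorb1)
  define h where "h = (\<lambda>\<sigma>. \<Sum>j<N. coef (pattern n N (z \<sigma>)) j * f (z \<sigma> j))"
  have h_meas: "h \<in> borel_measurable (restrict_space borel Z)"
    unfolding h_def
  proof (intro borel_measurable_sum borel_measurable_times)
    fix j assume "j \<in> {..<N}"
    then have "(\<lambda>\<sigma>. z \<sigma> j) \<in> measurable (restrict_space borel Z) (restrict_space (prod_space n X) S)"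
      using Z_S z_meas unfolding MZ
      by (intro measurable_restrict_space2 measurable_restrict_space1) (auto simp: space_restrict_space)
    from measurable_compose[OF this f(1)]
    show "(\<lambda>\<sigma>. f (z \<sigma> j)) \<in> borel_measurable (restrict_space borel Z)" .
    have "(\<lambda>Q. coef Q j) \<in> borel_measurable (count_space (Pow ?I))" by simp
    from measurable_compose[OF pat_meas this]
    show "(\<lambda>\<sigma>. coef (pattern n N (z \<sigma>)) j) \<in> borel_measurable (restrict_space borel Z)"
      unfolding MZ by (rule measurable_restrict_space1)
  qed
  have h_u: "h \<sigma> = u i (z \<sigma> 1 i) - u i (w i)" if "\<sigma> \<in> Z" for \<sigma>
  proof -
    have "\<exists>c. valid (pattern n N (z \<sigma>)) c" using that by (simp add: Z_def)
    then have "valid (pattern n N (z \<sigma>)) (coef (pattern n N (z \<sigma>)))"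
      unfolding coef_def by (rule someI_ex)
    then have "coordinate_identity n N i (coef (pattern n N (z \<sigma>))) (z \<sigma>)"
      by (simp add: valid_def)
    then have "(\<Sum>j<N. coef (pattern n N (z \<sigma>)) j * (\<Sum>k\<in>{1..n}. u k (z \<sigma> j k)))
        = u i (z \<sigma> 1 i) - u i (z \<sigma> 0 i)" by (simp add: coordinate_identity_def)
    moreover have "f (z \<sigma> j) = (\<Sum>k\<in>{1..n}. u k (z \<sigma> j k))" if "j < N" for j
      using u Z_S[OF \<open>\<sigma> \<in> Z\<close> that] by blast
    ultimately show ?thesis by (simp add: h_def z_def)
  qed
  obtain B where B: "\<And>x. x \<in> S \<Longrightarrow> norm (f x) \<le> B"
    using f(2) unfolding bounded_iff by auto
  have "0 \<le> B" using B[OF w] norm_ge_zero order_trans by blast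
  define b where "b = (\<Sum>Q\<in>Pow ?I. \<Sum>j<N. norm (coef Q j) * B)"
  have h_b: "norm (h \<sigma>) \<le> b" if "\<sigma> \<in> Z" for \<sigma>
  proof -
    have "norm (h \<sigma>) \<le> (\<Sum>j<N. norm (coef (pattern n N (z \<sigma>)) j) * B)"
      unfolding h_def using B Z_S[OF that]
      by (intro sum_norm_le) (auto simp: norm_mult intro!: mult_left_mono)
    also have "\<dots> \<le> b"
      unfolding b_def
    proof (rule member_le_sum)
      show "pattern n N (z \<sigma>) \<in> Pow ?I" by (auto simp: pattern_def)
      show "0 \<le> (\<Sum>j<N. norm (coef Q j) * B)" for Q
        using \<open>0 \<le> B\<close> by (intro sum_nonneg mult_nonneg_nonneg) auto
    qed simp
    finally show ?thesis .
  qed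
  have gi: "(g i \<circ> slot 1 i) \<sigma> = z \<sigma> 1 i" for \<sigma> using i by (simp add: z_def)
  have "\<exists>v\<in>borel_measurable (borel_of (X i)). bounded (range v) \<and> (\<forall>\<sigma>\<in>Z. v ((g i \<circ> slot 1 i) \<sigma>) = h \<sigma>)"
  proof (rule Borel_factor_complex[OF Polish_Hausdorff[OF P[OF i]] slot_map[OF _ i] Z h_meas h_b])
    show "1 < N" using N by simp
    show "h \<sigma> = h \<tau>" if "\<sigma> \<in> Z" "\<tau> \<in> Z" "(g i \<circ> slot 1 i) \<sigma> = (g i \<circ> slot 1 i) \<tau>" for \<sigma> \<tau>
      using h_u[OF that(1)] h_u[OF that(2)] that(3) unfolding gi by simp
  qed
  then obtain v where v: "v \<in> borel_measurable (borel_of (X i))" "bounded (range v)"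
    "\<forall>\<sigma>\<in>Z. v ((g i \<circ> slot 1 i) \<sigma>) = h \<sigma>" by (elim bexE conjE)
  have "v (x i) = u i (x i) - u i (w i)" if x: "x \<in> S" for x
  proof -
    from path[OF x] obtain y c where y: "y 0 = w" "y 1 = x" "\<forall>j<N. y j \<in> S"
      and c: "coordinate_identity n N i c y" by (elim exE conjE)
    have "\<exists>\<rho>. \<rho> \<in> C k \<and> g k \<rho> = y j k" if "j < N" "k \<in> {1..n}" for j k
    proof -
      have "y j k \<in> g k ` C k"
        using prod_space_coordinate[OF S] y(3) that onto by simp
      then obtain \<rho> where "y j k = g k \<rho>" "\<rho> \<in> C k" by (rule imageE)
      then show ?thesis by (intro exI[of _ \<rho>]) simp
    qed
    then have "\<forall>k. \<exists>\<rho>. j < N \<and> k \<in> {1..n} \<longrightarrow> \<rho> \<in> C k \<and> g k \<rho> = y j k" for j by simp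
    then have "\<forall>j. \<exists>\<rho>. \<forall>k. j < N \<and> k \<in> {1..n} \<longrightarrow> \<rho> k \<in> C k \<and> g k (\<rho> k) = y j k"
      by (rule allI[OF choice])
    then obtain \<rho> where \<rho>: "\<forall>j k. j < N \<and> k \<in> {1..n} \<longrightarrow> \<rho> j k \<in> C k \<and> g k (\<rho> j k) = y j k"
      by (rule choice[THEN exE])
    define \<sigma> where "\<sigma> = (\<lambda>m. case prod_decode m of (a, b) \<Rightarrow> case prod_decode a of (j, k) \<Rightarrow> \<rho> j k b)"
    have slot_\<sigma>: "slot j k \<sigma> = \<rho> j k" for j k by (simp add: slot_def \<sigma>_def)
    have zy: "z \<sigma> j = y j" if "j < N" for j
    proof (cases "j = 0")
      case True
      then show ?thesis using y(1) by (simp add: z_def)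
    next
      case False
      have "y j \<in> extensional {1..n}" using prod_space_extensional[OF S] y(3) that by simp
      moreover have "z \<sigma> j \<in> extensional {1..n}"
        using False by (simp only: z_def if_False restrict_extensional)
      moreover have "z \<sigma> j k = y j k" if k: "k \<in> {1..n}" for k
      proof -
        have "g k (\<rho> j k) = y j k" using \<rho>[rule_format, OF conjI[OF \<open>j < N\<close> k]] by (rule conjunct2)
        then show ?thesis using False k by (simp only: z_def if_False restrict_apply if_True slot_\<sigma>)
      qed
      ultimately show ?thesis by (intro extensionalityI[of _ "{1..n}"])
    qed
    have pat: "pattern n N (z \<sigma>) = pattern n N y"
      unfolding pattern_alt
    proof (rule Collect_cong, rule conj_cong[OF refl])
      fix t assume "t \<in> ?I"
      then have "fst (snd t) < N" "snd (snd t) < N" by (simp_all only: mem_Times_iff lessThan_iff)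
      then show "(z \<sigma> (fst (snd t)) (fst t) = z \<sigma> (snd (snd t)) (fst t))
          \<longleftrightarrow> (y (fst (snd t)) (fst t) = y (snd (snd t)) (fst t))"
        by (simp only: zy)
    qed
    have "valid (pattern n N y) c"
      unfolding valid_def using coordinate_identity_pattern[OF c _ i N] by simp
    then have "\<exists>c. valid (pattern n N (z \<sigma>)) c" unfolding pat by (rule exI[of _ c])
    moreover have "\<sigma> \<in> K" using \<rho> by (simp add: K_def slot_\<sigma>)
    ultimately have "\<sigma> \<in> Z" using y(3) zy by (simp add: Z_def space_MK)
    then have "v (z \<sigma> 1 i) = u i (z \<sigma> 1 i) - u i (w i)"
      using v(3) h_u gi by simp
    then show ?thesis using zy[of 1] y(2) N by simp
  qed
  then show ?thesis using v(1,2) by (intro bexI[of _ v] conjI ballI)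
qed

section \<open>Marginal uniqueness\<close>

lemma marginals_determine_integral:
  fixes u :: "nat \<Rightarrow> 'a \<Rightarrow> complex"
  assumes \<nu>: "\<nu> \<in> same_marginals n X \<mu>"
    and u: "\<And>k. k \<in> {1..n} \<Longrightarrow> u k \<in> borel_measurable (borel_of (X k))"
      "\<And>k. k \<in> {1..n} \<Longrightarrow> bounded (u k ` topspace (X k))"
  shows "(\<integral>x. (\<Sum>k\<in>{1..n}. u k (x k)) \<partial>\<nu>)
    = (\<Sum>k\<in>{1..n}. \<integral>a. u k a \<partial>distr \<mu> (borel_of (X k)) (\<lambda>x. x k))"
proof -
  interpret prob_space \<nu> using \<nu> by (simp add: same_marginals_def)
  have sets: "sets \<nu> = sets (prod_space n X)" using \<nu> by (simp add: same_marginals_def)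
  have proj: "(\<lambda>x. x k) \<in> measurable \<nu> (borel_of (X k))" if "k \<in> {1..n}" for k
    using measurable_prod_coordinate[OF measurable_ident_sets[OF sets] that] .
  have "integrable \<nu> (\<lambda>x. u k (x k))" if k: "k \<in> {1..n}" for k
  proof -
    obtain B where "\<forall>a\<in>topspace (X k). norm (u k a) \<le> B"
      using u(2)[OF k] unfolding bounded_iff by auto
    then have "norm (u k (x k)) \<le> B" if "x \<in> space \<nu>" for x
      using measurable_space[OF proj[OF k] that] by simp
    then show ?thesis
      by (intro integrable_const_bound[of _ B] AE_I2 measurable_compose[OF proj[OF k] u(1)[OF k]])
  qed
  then have "(\<integral>x. (\<Sum>k\<in>{1..n}. u k (x k)) \<partial>\<nu>) = (\<Sum>k\<in>{1..n}. \<integral>x. u k (x k) \<partial>\<nu>)"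
    by (rule Bochner_Integration.integral_sum)
  also have "\<dots> = (\<Sum>k\<in>{1..n}. \<integral>a. u k a \<partial>distr \<nu> (borel_of (X k)) (\<lambda>x. x k))"
    by (intro sum.cong refl integral_distr[symmetric] proj u(1))
  also have "\<dots> = (\<Sum>k\<in>{1..n}. \<integral>a. u k a \<partial>distr \<mu> (borel_of (X k)) (\<lambda>x. x k))"
    using \<nu> by (intro sum.cong refl) (simp add: same_marginals_def)
  finally show ?thesis .
qed

text \<open>If \<open>\<mu>\<close> is a proper convex combination of \<open>\<nu>\<^sub>1\<close> and \<open>\<nu>\<^sub>2\<close>, both give full mass to \<open>S\<close>. There the
indicator of any measurable set is a sum of bounded Borel functions of single coordinates, and
the integral of such a sum is determined by the marginals.\<close>
lemma marginal_uniqueness_if_bounded_sums: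
  fixes n :: nat and X :: "nat \<Rightarrow> 'a topology" and S :: "(nat \<Rightarrow> 'a) set"
  assumes S: "S \<in> sets (prod_space n X)"
    and rep: "\<And>f :: (nat \<Rightarrow> 'a) \<Rightarrow> complex.
      f \<in> borel_measurable (restrict_space (prod_space n X) S) \<Longrightarrow> bounded (f ` S) \<Longrightarrow>
      \<exists>u :: nat \<Rightarrow> 'a \<Rightarrow> complex.
        (\<forall>i\<in>{1..n}. u i \<in> borel_measurable (borel_of (X i)) \<and> bounded (u i ` topspace (X i))) \<and>
        (\<forall>x\<in>S. f x = (\<Sum>i\<in>{1..n}. u i (x i)))"
  shows "marginal_uniqueness n X S"
  unfolding marginal_uniqueness_def
proof (intro conjI allI impI)
  fix \<mu> :: "(nat \<Rightarrow> 'a) measure"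
  assume "prob_space \<mu> \<and> sets \<mu> = sets (prod_space n X) \<and> measure \<mu> S = 1"
  then have \<mu>: "prob_space \<mu>" "sets \<mu> = sets (prod_space n X)" "measure \<mu> S = 1" by auto
  show "extreme_measure \<mu> (same_marginals n X \<mu>)"
    unfolding extreme_measure_def
  proof (intro conjI ballI allI impI)
    show "\<mu> \<in> same_marginals n X \<mu>" using \<mu> by (simp add: same_marginals_def)
    fix \<nu>\<^sub>1 \<nu>\<^sub>2 and t :: real
    assume \<nu>: "\<nu>\<^sub>1 \<in> same_marginals n X \<mu>" "\<nu>\<^sub>2 \<in> same_marginals n X \<mu>"
      and t: "0 < t \<and> t < 1 \<and> (\<forall>A\<in>sets \<mu>. measure \<mu> A = (1 - t) * measure \<nu>\<^sub>1 A + t * measure \<nu>\<^sub>2 A)"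
    have prob: "prob_space \<nu>\<^sub>1" "prob_space \<nu>\<^sub>2" using \<nu> by (simp_all add: same_marginals_def)
    have sets: "sets \<nu>\<^sub>1 = sets (prod_space n X)" "sets \<nu>\<^sub>2 = sets (prod_space n X)"
      using \<nu> by (simp_all add: same_marginals_def)
    have one: "1 = (1 - t) * measure \<nu>\<^sub>1 S + t * measure \<nu>\<^sub>2 S"
      using t \<mu> S by auto
    have le1: "measure \<nu>\<^sub>1 S \<le> 1" "measure \<nu>\<^sub>2 S \<le> 1"
      using prob by (simp_all add: prob_space.prob_le_1)
    have m1: "measure \<nu>\<^sub>1 S = 1"
    proof (rule ccontr)
      assume "measure \<nu>\<^sub>1 S \<noteq> 1"
      then have "(1 - t) * measure \<nu>\<^sub>1 S < (1 - t) * 1"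
        using t le1 by (intro mult_strict_left_mono) auto
      moreover have "t * measure \<nu>\<^sub>2 S \<le> t * 1" using t le1 by (intro mult_left_mono) auto
      ultimately show False using one by simp
    qed
    then have m2: "measure \<nu>\<^sub>2 S = 1" using one t by simp
    have rep_measure: "complex_of_real (measure \<nu> A) = (\<integral>x. (\<Sum>k\<in>{1..n}. u k (x k)) \<partial>\<nu>)"
      if "prob_space \<nu>" "sets \<nu> = sets (prod_space n X)" "measure \<nu> S = 1" "A \<in> sets (prod_space n X)"
        and u: "\<forall>i\<in>{1..n}. u i \<in> borel_measurable (borel_of (X i))"
          "\<forall>x\<in>S. complex_of_real (indicator A x) = (\<Sum>i\<in>{1..n}. u i (x i))"
      for \<nu> A and u :: "nat \<Rightarrow> 'a \<Rightarrow> complex"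
    proof -
      interpret prob_space \<nu> by (rule that(1))
      have A: "A \<in> sets \<nu>" and S': "S \<in> sets \<nu>" using that(2,4) S by simp_all
      have "AE x in \<nu>. x \<in> S" using that(3) S' by (simp add: AE_in_set_eq_1)
      then have ae: "AE x in \<nu>. complex_of_real (indicator A x) = (\<Sum>k\<in>{1..n}. u k (x k))"
        using u(2) by (auto elim: eventually_mono)
      have sm: "(\<lambda>x. \<Sum>k\<in>{1..n}. u k (x k)) \<in> borel_measurable \<nu>"
      proof (rule borel_measurable_sum)
        fix k assume k: "k \<in> {1..n}"
        show "(\<lambda>x. u k (x k)) \<in> borel_measurable \<nu>"
          using measurable_compose[OF measurable_prod_coordinate[OF measurable_ident_sets[OF that(2)] k]] u(1) k by blast
      qed
      have "complex_of_real (measure \<nu> A) = (\<integral>x. complex_of_real (indicator A x) \<partial>\<nu>)"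
        using A sets.sets_into_space[OF A] by (simp add: Int_absorb2)
      also have "\<dots> = (\<integral>x. (\<Sum>k\<in>{1..n}. u k (x k)) \<partial>\<nu>)"
        by (rule integral_cong_AE[OF _ sm ae]) (use A in measurable)
      finally show ?thesis .
    qed
    show "\<nu>\<^sub>1 = \<nu>\<^sub>2"
    proof (rule measure_eqI)
      show "sets \<nu>\<^sub>1 = sets \<nu>\<^sub>2" using sets by simp
      fix A assume "A \<in> sets \<nu>\<^sub>1"
      then have A: "A \<in> sets (prod_space n X)" using sets by simp
      let ?f = "\<lambda>x. complex_of_real (indicator A x)"
      have "?f \<in> borel_measurable (prod_space n X)" using A by measurable
      then have "?f \<in> borel_measurable (restrict_space (prod_space n X) S)"
        by (rule measurable_restrict_space1)
      moreover have "bounded (?f ` S)"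
        unfolding bounded_iff by (rule exI[of _ 1]) (auto simp: indicator_def)
      ultimately have "\<exists>u :: nat \<Rightarrow> 'a \<Rightarrow> complex.
        (\<forall>i\<in>{1..n}. u i \<in> borel_measurable (borel_of (X i)) \<and> bounded (u i ` topspace (X i))) \<and>
        (\<forall>x\<in>S. ?f x = (\<Sum>i\<in>{1..n}. u i (x i)))" by (rule rep)
      then obtain u :: "nat \<Rightarrow> 'a \<Rightarrow> complex" where
        u: "\<forall>i\<in>{1..n}. u i \<in> borel_measurable (borel_of (X i)) \<and> bounded (u i ` topspace (X i))"
          "\<forall>x\<in>S. ?f x = (\<Sum>i\<in>{1..n}. u i (x i))" by (elim exE conjE)
      have u1: "\<forall>i\<in>{1..n}. u i \<in> borel_measurable (borel_of (X i))" using u(1) by simp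
      have "complex_of_real (measure \<nu>\<^sub>1 A) = complex_of_real (measure \<nu>\<^sub>2 A)"
        unfolding rep_measure[OF prob(1) sets(1) m1 A u1 u(2)] rep_measure[OF prob(2) sets(2) m2 A u1 u(2)]
        using marginals_determine_integral[OF \<nu>(1), of u] marginals_determine_integral[OF \<nu>(2), of u] u(1)
        by simp
      then have "measure \<nu>\<^sub>1 A = measure \<nu>\<^sub>2 A" by (simp only: of_real_eq_iff)
      then show "emeasure \<nu>\<^sub>1 A = emeasure \<nu>\<^sub>2 A"
        using prob by (simp add: finite_measure.emeasure_eq_measure prob_space.finite_measure)
    qed
  qed
qed (rule S)

section \<open>Bounded geodesics and bounded Borel summands\<close>

theorem mainTheorem1:
  fixes n :: nat and X :: "nat \<Rightarrow> 'a topology" and S :: "(nat \<Rightarrow> 'a) set"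
  assumes "n \<ge> 2"
    and "\<And>i. i \<in> {1..n} \<Longrightarrow> Polish_space (X i)"
    and "S \<in> sets (prod_space n X)"
    and "good n S"
    and "\<And>x y. x \<in> S \<Longrightarrow> y \<in> S \<Longrightarrow> related n S x y"
    and "\<exists>L::nat. \<forall>x\<in>S. \<forall>y\<in>S. \<forall>F. geodesic n S x y F \<longrightarrow> card F \<le> L"
  shows "(\<forall>f :: (nat \<Rightarrow> 'a) \<Rightarrow> complex.
            f \<in> borel_measurable (restrict_space (prod_space n X) S) \<and> bounded (f ` S) \<longrightarrow>
            (\<exists>u :: nat \<Rightarrow> 'a \<Rightarrow> complex.
               (\<forall>i\<in>{1..n}. u i \<in> borel_measurable (borel_of (X i)) \<and>
                           bounded (u i ` topspace (X i))) \<and>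
               (\<forall>x\<in>S. f x = (\<Sum>i\<in>{1..n}. u i (x i)))))
         \<and> marginal_uniqueness n X S"
proof -
  obtain L where L: "\<And>x y F. x \<in> S \<Longrightarrow> y \<in> S \<Longrightarrow> geodesic n S x y F \<Longrightarrow> card F \<le> L"
    using assms(6) by blast
  have path: "\<exists>F. joining_path n S x y F \<and> card F \<le> L" if "x \<in> S" "y \<in> S" for x y
  proof -
    have "\<exists>F. joining_path n S x y F" using assms(5)[OF that] by (simp add: related_def)
    then obtain F where "joining_path n S x y F" "\<forall>G. joining_path n S x y G \<longrightarrow> card F \<le> card G"
      using ex_has_least_nat[of "joining_path n S x y" _ card] by blast
    then show ?thesis using L[OF that] by (intro exI[of _ F]) (simp add: geodesic_def)
  qed
  have rep: "\<exists>u :: nat \<Rightarrow> 'a \<Rightarrow> complex.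
       (\<forall>i\<in>{1..n}. u i \<in> borel_measurable (borel_of (X i)) \<and> bounded (u i ` topspace (X i))) \<and>
       (\<forall>x\<in>S. f x = (\<Sum>i\<in>{1..n}. u i (x i)))"
    if f: "f \<in> borel_measurable (restrict_space (prod_space n X) S)" "bounded (f ` S)"
    for f :: "(nat \<Rightarrow> 'a) \<Rightarrow> complex"
  proof (cases "S = {}")
    case True
    have "bounded ((\<lambda>_. 0 :: complex) ` A)" for A :: "'a set"
      by (rule bounded_subset[of "{0}"]) auto
    with True show ?thesis by (intro exI[of _ "\<lambda>_ _. 0"]) simp
  next
    case False
    then obtain w where w: "w \<in> S" by blast
    from assms(4)[unfolded good_def, THEN spec, of f]
    obtain p where p: "\<forall>x\<in>S. f x = (\<Sum>i\<in>{1..n}. p i (x i))" by (rule exE)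
    have "\<forall>i\<in>{1..n}. \<exists>v. v \<in> borel_measurable (borel_of (X i)) \<and> bounded (range v)
        \<and> (\<forall>x\<in>S. v (x i) = p i (x i) - p i (w i))"
    proof
      fix i assume i: "i \<in> {1..n}"
      have "\<exists>v\<in>borel_measurable (borel_of (X i)). bounded (range v) \<and> (\<forall>x\<in>S. v (x i) = p i (x i) - p i (w i))"
      proof (rule coordinate_function_Borel[OF assms(2,3) w i _ f p])
        show "2 \<le> L + 2" by simp
        fix x assume x: "x \<in> S"
        from path[OF w x] obtain F where F: "finite F" "full n F" "F \<subseteq> S" "w \<in> F" "x \<in> F" "card F \<le> L"
          unfolding joining_path_def by blast
        from full_coordinate_identity[OF F(1,2) F(5,4) i F(6)]
        obtain z c where "z 0 = w" "z 1 = x" "\<forall>j<L + 2. z j \<in> F" "coordinate_identity n (L + 2) i c z"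
          by (elim exE conjE)
        moreover from this have "\<forall>j<L + 2. z j \<in> S" using F(3) by (simp add: subset_iff)
        ultimately show "\<exists>z c. z 0 = w \<and> z 1 = x \<and> (\<forall>j<L + 2. z j \<in> S) \<and> coordinate_identity n (L + 2) i c z"
          by (intro exI[of _ z] exI[of _ c] conjI)
      qed
      then show "\<exists>v. v \<in> borel_measurable (borel_of (X i)) \<and> bounded (range v)
        \<and> (\<forall>x\<in>S. v (x i) = p i (x i) - p i (w i))" by (simp add: Bex_def)
    qed
    then obtain v where v: "\<forall>i\<in>{1..n}. v i \<in> borel_measurable (borel_of (X i)) \<and> bounded (range (v i))
        \<and> (\<forall>x\<in>S. v i (x i) = p i (x i) - p i (w i))" by (rule bchoice[THEN exE])
    define u where "u = (\<lambda>i a. v i a + p i (w i))"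
    have "u i \<in> borel_measurable (borel_of (X i)) \<and> bounded (u i ` topspace (X i))" if i: "i \<in> {1..n}" for i
    proof
      have vi: "v i \<in> borel_measurable (borel_of (X i))" "bounded (range (v i))" using v i by simp_all
      show "u i \<in> borel_measurable (borel_of (X i))"
        unfolding u_def by (rule borel_measurable_add[OF vi(1) borel_measurable_const])
      obtain B where B: "norm (v i a) \<le> B" for a using vi(2) unfolding bounded_iff by auto
      have "norm (u i a) \<le> B + norm (p i (w i))" for a
        unfolding u_def by (rule order_trans[OF norm_triangle_ineq add_right_mono[OF B]])
      then show "bounded (u i ` topspace (X i))"
        unfolding bounded_iff by (intro exI[of _ "B + norm (p i (w i))"]) simp
    qed
    moreover have "f x = (\<Sum>i\<in>{1..n}. u i (x i))" if "x \<in> S" for x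
    proof -
      have "u i (x i) = p i (x i)" if "i \<in> {1..n}" for i
        using v that \<open>x \<in> S\<close> by (simp add: u_def)
      then show ?thesis using p that by simp
    qed
    ultimately show ?thesis by (intro exI[of _ u]) simp
  qed
  have "marginal_uniqueness n X S"
  proof (rule marginal_uniqueness_if_bounded_sums[OF assms(3)])
    fix f :: "(nat \<Rightarrow> 'a) \<Rightarrow> complex"
    assume "f \<in> borel_measurable (restrict_space (prod_space n X) S)" "bounded (f ` S)"
    then show "\<exists>u :: nat \<Rightarrow> 'a \<Rightarrow> complex.
       (\<forall>i\<in>{1..n}. u i \<in> borel_measurable (borel_of (X i)) \<and> bounded (u i ` topspace (X i))) \<and>
       (\<forall>x\<in>S. f x = (\<Sum>i\<in>{1..n}. u i (x i)))"
      by (rule rep)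
  qed
  moreover have "\<forall>f :: (nat \<Rightarrow> 'a) \<Rightarrow> complex.
      f \<in> borel_measurable (restrict_space (prod_space n X) S) \<and> bounded (f ` S) \<longrightarrow>
      (\<exists>u :: nat \<Rightarrow> 'a \<Rightarrow> complex.
         (\<forall>i\<in>{1..n}. u i \<in> borel_measurable (borel_of (X i)) \<and> bounded (u i ` topspace (X i))) \<and>
         (\<forall>x\<in>S. f x = (\<Sum>i\<in>{1..n}. u i (x i))))"
    by (intro allI impI, elim conjE, rule rep)
  ultimately show ?thesis by (intro conjI)
qed

end
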